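(* Let $G$ be a group, let $\phi\colon G\to\mathbb{R}$ be a non-trivial homomorphism, let $n\geqslant 0$ be an integer, and let $C_\bullet$ be a chain complex of finitely generated projective left $\mathbb{Z}G$-modules without negative terms. If $H_i(\widehat{\mathbb{Q}G}^{\phi}\otimes_{\mathbb{Z}G}C_\bullet)=0$ for all $i\leqslant n$, then there is a finite collection of primes $\mathcal{P}$ such that $$H_i(\widehat{\mathbb{Z}_{\mathcal{P}}G}^{\phi}\otimes_{\mathbb{Z}G}C_\bullet)=0$$ for all $i\leqslant n$.
   Context: For a ring $R$, a group $G$ and a homomorphism $\phi\colon G\to\mathbb{R}$, the Novikov ring $\widehat{RG}^{\phi}$ is the set of functions $x\colon G\to R$ such that $\{g\in G: x(g)\neq 0,\ \phi(g)\leqslant\kappa\}$ is finite for every $\kappa\in\mathbb{R}$, with pointwise addition and convolution as multiplication. It contains the group ring $RG$ (finitely supported functions). For a set of primes $\mathcal{P}$, $\mathbb{Z}_{\mathcal{P}}$ denotes the subring of $\mathbb{Q}$ consisting of fractions whose denominators are products of powers of primes in $\mathcal{P}$ (i.e. the primes in $\mathcal{P}$ are inverted). *)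

theory Defs
  imports Complex_Main "HOL-Algebra.Module" "HOL-Algebra.Generated_Groups"
    "HOL-Algebra.Free_Abelian_Groups" "HOL-Computational_Algebra.Primes"
begin

subsection \<open>Coefficient rings\<close>

text \<open>
  The coefficient rings below are subrings of the rationals and are represented by
  their carrier in the type \<^typ>\<open>rat\<close>. Thus \<^prop>\<open>\<int> \<subseteq> localized_ints P\<close>, and the group
  ring over the integers is literally a subring of each of the Novikov rings used.
\<close>

definition rat_ring :: "rat set \<Rightarrow> rat ring"
  where "rat_ring S = \<lparr>carrier = S, monoid.mult = (*), one = 1, ring.zero = 0, add = (+)\<rparr>"

definition localized_ints :: "nat set \<Rightarrow> rat set"
  where "localized_ints P =
    {of_int a / of_nat b | (a::int) (b::nat). b \<noteq> 0 \<and> prime_factors b \<subseteq> P}"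

definition real_additive_group :: "real monoid"
  where "real_additive_group = \<lparr>carrier = UNIV, monoid.mult = (+), one = 0\<rparr>"

subsection \<open>Group rings and Novikov rings\<close>

text \<open>
  Functions on a group are extensional, that is, \<^const>\<open>undefined\<close> outside the carrier.
  In the convolution, summing over those \<open>h\<close> for which both factors are nonzero makes the index
  set finite for elements of a Novikov ring (\<^const>\<open>finsum\<close> over an infinite set is zero).
\<close>

definition convolution ::
  "('r, 'k) ring_scheme \<Rightarrow> ('g, 'l) monoid_scheme \<Rightarrow> ('g \<Rightarrow> 'r) \<Rightarrow> ('g \<Rightarrow> 'r) \<Rightarrow> 'g \<Rightarrow> 'r"
  where "convolution R G x y = (\<lambda>g\<in>carrier G.
    finsum R (\<lambda>h. x h \<otimes>\<^bsub>R\<^esub> y (inv\<^bsub>G\<^esub> h \<otimes>\<^bsub>G\<^esub> g))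
      {h \<in> carrier G. x h \<noteq> \<zero>\<^bsub>R\<^esub> \<and> y (inv\<^bsub>G\<^esub> h \<otimes>\<^bsub>G\<^esub> g) \<noteq> \<zero>\<^bsub>R\<^esub>})"

definition convolution_ring ::
  "('r, 'k) ring_scheme \<Rightarrow> ('g, 'l) monoid_scheme \<Rightarrow> ('g \<Rightarrow> 'r) set \<Rightarrow> ('g \<Rightarrow> 'r) ring"
  where "convolution_ring R G A =
    \<lparr>carrier = A,
     monoid.mult = convolution R G,
     one = (\<lambda>g\<in>carrier G. if g = \<one>\<^bsub>G\<^esub> then \<one>\<^bsub>R\<^esub> else \<zero>\<^bsub>R\<^esub>),
     ring.zero = (\<lambda>g\<in>carrier G. \<zero>\<^bsub>R\<^esub>),
     add = (\<lambda>x y. \<lambda>g\<in>carrier G. x g \<oplus>\<^bsub>R\<^esub> y g)\<rparr>"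

definition group_ring ::
  "('r, 'k) ring_scheme \<Rightarrow> ('g, 'l) monoid_scheme \<Rightarrow> ('g \<Rightarrow> 'r) ring"
  where "group_ring R G = convolution_ring R G
    {x \<in> carrier G \<rightarrow>\<^sub>E carrier R. finite {g \<in> carrier G. x g \<noteq> \<zero>\<^bsub>R\<^esub>}}"

definition novikov_ring ::
  "('r, 'k) ring_scheme \<Rightarrow> ('g, 'l) monoid_scheme \<Rightarrow> ('g \<Rightarrow> real) \<Rightarrow> ('g \<Rightarrow> 'r) ring"
  where "novikov_ring R G \<phi> = convolution_ring R G
    {x \<in> carrier G \<rightarrow>\<^sub>E carrier R.
      \<forall>\<kappa>::real. finite {g \<in> carrier G. x g \<noteq> \<zero>\<^bsub>R\<^esub> \<and> \<phi> g \<le> \<kappa>}}"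

subsection \<open>Left modules over a not necessarily commutative ring\<close>

text \<open>
  The library locale \<^locale>\<open>module\<close> requires a commutative ring. As there, the fields
  \<open>mult\<close> and \<open>one\<close> of a module record play no role.
\<close>

locale left_module = R?: ring R + M?: abelian_group M
  for R :: "('r, 'k) ring_scheme" (structure) and M :: "('r, 'm) module" (structure) +
  assumes smult_closed: "\<lbrakk>a \<in> carrier R; x \<in> carrier M\<rbrakk> \<Longrightarrow> a \<odot>\<^bsub>M\<^esub> x \<in> carrier M"
    and smult_l_distr: "\<lbrakk>a \<in> carrier R; b \<in> carrier R; x \<in> carrier M\<rbrakk> \<Longrightarrow>
      (a \<oplus> b) \<odot>\<^bsub>M\<^esub> x = a \<odot>\<^bsub>M\<^esub> x \<oplus>\<^bsub>M\<^esub> b \<odot>\<^bsub>M\<^esub> x"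
    and smult_r_distr: "\<lbrakk>a \<in> carrier R; x \<in> carrier M; y \<in> carrier M\<rbrakk> \<Longrightarrow>
      a \<odot>\<^bsub>M\<^esub> (x \<oplus>\<^bsub>M\<^esub> y) = a \<odot>\<^bsub>M\<^esub> x \<oplus>\<^bsub>M\<^esub> a \<odot>\<^bsub>M\<^esub> y"
    and smult_assoc1: "\<lbrakk>a \<in> carrier R; b \<in> carrier R; x \<in> carrier M\<rbrakk> \<Longrightarrow>
      (a \<otimes> b) \<odot>\<^bsub>M\<^esub> x = a \<odot>\<^bsub>M\<^esub> (b \<odot>\<^bsub>M\<^esub> x)"
    and smult_one: "x \<in> carrier M \<Longrightarrow> \<one> \<odot>\<^bsub>M\<^esub> x = x"

definition left_module_hom ::
  "('r, 'k) ring_scheme \<Rightarrow> ('r, 'a) module \<Rightarrow> ('r, 'b) module \<Rightarrow> ('a \<Rightarrow> 'b) set"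
  where "left_module_hom R M N =
    {f \<in> carrier M \<rightarrow> carrier N.
      (\<forall>x\<in>carrier M. \<forall>y\<in>carrier M. f (x \<oplus>\<^bsub>M\<^esub> y) = f x \<oplus>\<^bsub>N\<^esub> f y) \<and>
      (\<forall>a\<in>carrier R. \<forall>x\<in>carrier M. f (a \<odot>\<^bsub>M\<^esub> x) = a \<odot>\<^bsub>N\<^esub> f x)}"

definition fin_gen_module :: "('r, 'k) ring_scheme \<Rightarrow> ('r, 'm) module \<Rightarrow> bool"
  where "fin_gen_module R M \<longleftrightarrow>
    (\<exists>S \<subseteq> carrier M. finite S \<and>
      (\<forall>x\<in>carrier M. \<exists>c\<in>S \<rightarrow> carrier R. x = finsum M (\<lambda>s. c s \<odot>\<^bsub>M\<^esub> s) S))"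

text \<open>
  The lifting property. HOL cannot quantify over all types inside a definition, so the modules
  \<open>A\<close> and \<open>B\<close> range over those with carrier in \<^typ>\<open>'m \<Rightarrow> 'r\<close> and \<^typ>\<open>'m\<close>. No generality is
  lost: taking for \<open>A\<close> the free module on the carrier of \<open>M\<close> (finitely supported functions)
  and \<open>B = M\<close> shows that \<open>M\<close> is a direct summand of a free module, hence has the lifting
  property for modules of arbitrary type.
\<close>

definition projective_module :: "('r, 'k) ring_scheme \<Rightarrow> ('r, 'm) module \<Rightarrow> bool"
  where "projective_module R M \<longleftrightarrow>
    (\<forall>(A :: ('r, 'm \<Rightarrow> 'r) module) (B :: ('r, 'm) module) p f.
      left_module R A \<longrightarrow> left_module R B \<longrightarrow>
      p \<in> left_module_hom R A B \<longrightarrow> p ` carrier A = carrier B \<longrightarrow>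
      f \<in> left_module_hom R M B \<longrightarrow>
      (\<exists>g\<in>left_module_hom R M A. \<forall>x\<in>carrier M. p (g x) = f x))"

definition chain_complex ::
  "('r, 'k) ring_scheme \<Rightarrow> (int \<Rightarrow> ('r, 'm) module) \<Rightarrow> (int \<Rightarrow> 'm \<Rightarrow> 'm) \<Rightarrow> bool"
  where "chain_complex R C d \<longleftrightarrow>
    (\<forall>i. left_module R (C i)) \<and>
    (\<forall>i. d i \<in> left_module_hom R (C i) (C (i - 1))) \<and>
    (\<forall>i. \<forall>x\<in>carrier (C i). d (i - 1) (d i x) = \<zero>\<^bsub>C (i - 2)\<^esub>)"

subsection \<open>Tensor products and homology\<close>

text \<open>
  For a subring \<open>R\<close> of a ring \<open>S\<close> and a left \<open>R\<close>-module \<open>M\<close>, the tensor product of \<open>S\<close> (as a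
  right \<open>R\<close>-module by multiplication) and \<open>M\<close> over \<open>R\<close> is the free abelian group on the pairs
  \<open>(s, m)\<close>, where \<open>frag_of (s, m)\<close> is a basis element, modulo the usual relations. Only its
  underlying abelian group is recorded, written multiplicatively as are all groups in
  \<^theory>\<open>HOL-Algebra.Group\<close>.
\<close>

definition tensor_relations ::
  "('r, 'k) ring_scheme \<Rightarrow> ('r, 'l) ring_scheme \<Rightarrow> ('r, 'm) module \<Rightarrow> ('r \<times> 'm \<Rightarrow>\<^sub>0 int) set"
  where "tensor_relations R S M =
    {frag_of (s \<oplus>\<^bsub>S\<^esub> t, m) - frag_of (s, m) - frag_of (t, m) | s t m.
      s \<in> carrier S \<and> t \<in> carrier S \<and> m \<in> carrier M} \<union>
    {frag_of (s, m \<oplus>\<^bsub>M\<^esub> n) - frag_of (s, m) - frag_of (s, n) | s m n.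
      s \<in> carrier S \<and> m \<in> carrier M \<and> n \<in> carrier M} \<union>
    {frag_of (s \<otimes>\<^bsub>S\<^esub> r, m) - frag_of (s, r \<odot>\<^bsub>M\<^esub> m) | s r m.
      s \<in> carrier S \<and> r \<in> carrier R \<and> m \<in> carrier M}"

definition tensor_free_group ::
  "('r, 'l) ring_scheme \<Rightarrow> ('r, 'm) module \<Rightarrow> ('r \<times> 'm \<Rightarrow>\<^sub>0 int) monoid"
  where "tensor_free_group S M = free_Abelian_group (carrier S \<times> carrier M)"

definition tensor_subgroup ::
  "('r, 'k) ring_scheme \<Rightarrow> ('r, 'l) ring_scheme \<Rightarrow> ('r, 'm) module \<Rightarrow> ('r \<times> 'm \<Rightarrow>\<^sub>0 int) set"
  where "tensor_subgroup R S M = generate (tensor_free_group S M) (tensor_relations R S M)"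

definition tensor_product ::
  "('r, 'k) ring_scheme \<Rightarrow> ('r, 'l) ring_scheme \<Rightarrow> ('r, 'm) module \<Rightarrow>
    ('r \<times> 'm \<Rightarrow>\<^sub>0 int) set monoid"
  where "tensor_product R S M = tensor_free_group S M Mod tensor_subgroup R S M"

text \<open>
  The map induced by \<open>f\<close> on tensor products. Its argument \<open>K\<close> is a coset; if \<open>f\<close> is a module
  homomorphism, all members of the union are the same coset.
\<close>

definition tensor_map ::
  "('r, 'k) ring_scheme \<Rightarrow> ('r, 'l) ring_scheme \<Rightarrow> ('r, 'b) module \<Rightarrow> ('a \<Rightarrow> 'b) \<Rightarrow>
    ('r \<times> 'a \<Rightarrow>\<^sub>0 int) set \<Rightarrow> ('r \<times> 'b \<Rightarrow>\<^sub>0 int) set"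
  where "tensor_map R S N f K =
    (\<Union>x\<in>K. tensor_subgroup R S N #>\<^bsub>tensor_free_group S N\<^esub>
       frag_extend (\<lambda>(s, m). frag_of (s, f m)) x)"

definition homology ::
  "(int \<Rightarrow> 'a monoid) \<Rightarrow> (int \<Rightarrow> 'a \<Rightarrow> 'a) \<Rightarrow> int \<Rightarrow> 'a set monoid"
  where "homology D \<delta> i =
    (D i)\<lparr>carrier := kernel (D i) (D (i - 1)) (\<delta> i)\<rparr> Mod (\<delta> (i + 1) ` carrier (D (i + 1)))"

definition tensor_homology ::
  "('r, 'k) ring_scheme \<Rightarrow> ('r, 'l) ring_scheme \<Rightarrow> (int \<Rightarrow> ('r, 'm) module) \<Rightarrow>
    (int \<Rightarrow> 'm \<Rightarrow> 'm) \<Rightarrow> int \<Rightarrow> ('r \<times> 'm \<Rightarrow>\<^sub>0 int) set set monoid"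
  where "tensor_homology R S C d =
    homology (\<lambda>i. tensor_product R S (C i)) (\<lambda>i. tensor_map R S (C (i - 1)) (d i))"

end

(*
  A finitely generated projective module has a finite dual basis, so a tensor product with it is
  the module of row vectors fixed by an idempotent matrix, and the differentials become matrices
  over the integral group ring. Exactness over the rational Novikov ring in degrees up to n gives
  inductively matrices s over that ring with z s D = z for all cycles z. Replace s by a truncation
  s' with finitely supported entries, which involve finitely many denominators. If the truncation
  is late enough, z - z s' D = z (s - s') D has larger support bound than z, so iterating
  z |-> z - z s' D produces a series that converges in the Novikov ring over the localization and
  whose sum w satisfies w D = z.
*)
theory Submission
  imports Defs "HOL-Algebra.Subrings"
begin

subsection \<open>Subrings of the rationals\<close>

text \<open>The primes must be chosen once for all cycles, yet a cycle may have infinitely many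
  nonzero coefficients, and its rational preimage infinitely many denominators. So it does not help
  to lift cycles one at a time: what is truncated is a single splitting matrix per degree. It exists
  because the rows of e - D s e, with s the splitting one degree lower, are finitely many cycles,
  and multiplication by this matrix fixes every cycle. The induction starts where the complex
  vanishes. The entries of D may have support where phi is negative, down to some -c, so s - s' has
  to start at level c + 1 for each round to gain 1. This level depends on D but not on the
  cycle.\<close>

definition rat_subring :: "rat set \<Rightarrow> bool"
  where "rat_subring A \<longleftrightarrow> 0 \<in> A \<and> 1 \<in> A \<and>
    (\<forall>x\<in>A. \<forall>y\<in>A. x + y \<in> A \<and> x * y \<in> A) \<and> (\<forall>x\<in>A. - x \<in> A)"

lemma rat_subringD:
  assumes "rat_subring A"
  shows "0 \<in> A" "1 \<in> A" "\<And>x y. x \<in> A \<Longrightarrow> y \<in> A \<Longrightarrow> x + y \<in> A"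
    "\<And>x y. x \<in> A \<Longrightarrow> y \<in> A \<Longrightarrow> x * y \<in> A" "\<And>x. x \<in> A \<Longrightarrow> - x \<in> A"
  using assms by (auto simp: rat_subring_def)

lemma sum_in_rat_subring:
  assumes "rat_subring A" "\<And>x. x \<in> B \<Longrightarrow> f x \<in> A"
  shows "sum f B \<in> A"
  using assms(2)
  by (induction B rule: infinite_finite_induct) (auto intro: rat_subringD[OF assms(1)])

lemma rat_subring_Ints: "rat_subring \<int>"
  by (simp add: rat_subring_def)

lemma rat_subring_Rats: "rat_subring \<rat>"
  by (simp add: rat_subring_def)

text \<open>Library sums in \<open>rat_ring A\<close> become ordinary sums of rationals, which no
  longer depend on \<open>A\<close>; this lets convolutions over different coefficient rings be
  compared.\<close>

lemma finsum_rat_ring: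
  assumes A: "rat_subring A" and f: "f \<in> B \<rightarrow> A"
  shows "finsum (rat_ring A) f B = sum f B"
proof -
  interpret abelian_monoid "rat_ring A"
    by (rule abelian_monoidI) (auto simp: rat_ring_def intro: rat_subringD[OF A])
  have [simp]: "carrier (rat_ring A) = A" "\<zero>\<^bsub>rat_ring A\<^esub> = 0" "add (rat_ring A) = (+)"
    by (simp_all add: rat_ring_def)
  show ?thesis using f
    by (induction B rule: infinite_finite_induct) auto
qed

lemma localized_ints_mono: "P \<subseteq> Q \<Longrightarrow> localized_ints P \<subseteq> localized_ints Q"
  unfolding localized_ints_def by blast

lemma Ints_subset_localized_ints: "\<int> \<subseteq> localized_ints P"
proof
  fix x :: rat assume "x \<in> \<int>"
  then obtain a where "x = of_int a" by (auto elim: Ints_cases)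
  then have "x = of_int a / of_nat 1 \<and> (1::nat) \<noteq> 0 \<and> prime_factors (1::nat) \<subseteq> P" by simp
  then show "x \<in> localized_ints P" unfolding localized_ints_def by blast
qed

lemma localized_ints_subset_Rats: "localized_ints P \<subseteq> \<rat>"
  unfolding localized_ints_def by auto

lemma rat_subring_localized_ints: "rat_subring (localized_ints P)"
proof -
  have "x + y \<in> localized_ints P \<and> x * y \<in> localized_ints P \<and> - x \<in> localized_ints P"
    if xy: "x \<in> localized_ints P" "y \<in> localized_ints P" for x y
  proof -
    obtain a b where x: "x = of_int a / of_nat b" "b \<noteq> 0" "prime_factors b \<subseteq> P"
      using xy(1) unfolding localized_ints_def by blast
    obtain c d where y: "y = of_int c / of_nat d" "d \<noteq> 0" "prime_factors d \<subseteq> P"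
      using xy(2) unfolding localized_ints_def by blast
    have pf: "b * d \<noteq> 0" "prime_factors (b * d) \<subseteq> P"
      using x y by (auto simp: prime_factors_product)
    have 1: "x + y = of_int (a * int d + c * int b) / of_nat (b * d)"
      using x y by (simp add: field_simps)
    have 2: "x * y = of_int (a * c) / of_nat (b * d)"
      using x y by (simp add: field_simps)
    have 3: "- x = of_int (- a) / of_nat b"
      using x by simp
    show ?thesis
      unfolding localized_ints_def using 1 2 3 pf x by blast
  qed
  moreover have "0 \<in> localized_ints P" "1 \<in> localized_ints P"
    using subsetD[OF Ints_subset_localized_ints Ints_0] subsetD[OF Ints_subset_localized_ints Ints_1]
    by auto
  ultimately show ?thesis unfolding rat_subring_def by blast
qed

text \<open>The prime factors of the reduced denominators suffice. Every prime that is finally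
  inverted is chosen here.\<close>

lemma finite_rats_localized:
  assumes "finite (B :: rat set)"
  shows "\<exists>P. finite P \<and> (\<forall>p\<in>P. prime p) \<and> B \<subseteq> localized_ints P"
proof -
  have "\<exists>P. finite P \<and> (\<forall>p\<in>P. prime p) \<and> x \<in> localized_ints P" for x :: rat
  proof -
    obtain a b where q: "quotient_of x = (a, b)" by fastforce
    have b: "b > 0" using q quotient_of_denom_pos by blast
    have "x = of_int a / of_nat (nat b)"
      using quotient_of_div[OF q] b by simp
    then have "x \<in> localized_ints (prime_factors (nat b))"
      using b unfolding localized_ints_def by fastforce
    then show ?thesis by (intro exI[of _ "prime_factors (nat b)"]) auto
  qed
  then obtain P where P: "\<And>x. finite (P x) \<and> (\<forall>p\<in>P x. prime p) \<and> x \<in> localized_ints (P x)"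
    by metis
  have "x \<in> localized_ints (\<Union>x\<in>B. P x)" if "x \<in> B" for x
    using P[of x] localized_ints_mono[of "P x" "\<Union>x\<in>B. P x"] that by blast
  then show ?thesis
    using P assms by (intro exI[of _ "\<Union>x\<in>B. P x"]) auto
qed

subsection \<open>Novikov rings and their filtration\<close>

locale novikov = group G for G :: "('g, 'k) monoid_scheme" (structure) +
  fixes \<phi> :: "'g \<Rightarrow> real"
  assumes hom: "\<phi> \<in> hom G real_additive_group"
begin

abbreviation nov :: "rat set \<Rightarrow> ('g \<Rightarrow> rat) ring"
  where "nov A \<equiv> novikov_ring (rat_ring A) G \<phi>"

text \<open>Convolution over the rationals serves as the product for all coefficient rings;
  \<open>convolution_eq_conv\<close> justifies this.\<close>

abbreviation conv :: "('g \<Rightarrow> rat) \<Rightarrow> ('g \<Rightarrow> rat) \<Rightarrow> ('g \<Rightarrow> rat)"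
  where "conv \<equiv> convolution (rat_ring \<rat>) G"

text \<open>The decreasing filtration attached to the smallest value of phi on the support. It acts
  like an adic topology: \<open>filt_separated\<close> gives uniqueness of limits and
  \<open>filt_complete\<close> their existence.\<close>

definition filt :: "real \<Rightarrow> ('g \<Rightarrow> rat) set"
  where "filt a = {x \<in> carrier (nov \<rat>). \<forall>g\<in>carrier G. x g \<noteq> 0 \<longrightarrow> a \<le> \<phi> g}"

lemma \<phi>_mult: "g \<in> carrier G \<Longrightarrow> h \<in> carrier G \<Longrightarrow> \<phi> (g \<otimes> h) = \<phi> g + \<phi> h"
  using hom by (simp add: hom_def real_additive_group_def)

lemma \<phi>_one: "\<phi> \<one> = 0"
  using \<phi>_mult[of \<one> \<one>] by simp

lemma \<phi>_inv: "g \<in> carrier G \<Longrightarrow> \<phi> (inv g) = - \<phi> g"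
  using \<phi>_mult[of g "inv g"] \<phi>_one by simp

lemma carrier_nov:
  "carrier (nov A) =
    {x \<in> carrier G \<rightarrow>\<^sub>E A. \<forall>\<kappa>. finite {g \<in> carrier G. x g \<noteq> 0 \<and> \<phi> g \<le> \<kappa>}}"
  by (simp add: novikov_ring_def convolution_ring_def rat_ring_def)

lemma nov_sel:
  "\<zero>\<^bsub>nov A\<^esub> = (\<lambda>g\<in>carrier G. 0)"
  "\<one>\<^bsub>nov A\<^esub> = (\<lambda>g\<in>carrier G. if g = \<one> then 1 else 0)"
  "add (nov A) = (\<lambda>x y. \<lambda>g\<in>carrier G. x g + y g)"
  "monoid.mult (nov A) = convolution (rat_ring A) G"
  by (simp_all add: novikov_ring_def convolution_ring_def rat_ring_def cong: if_cong)

lemma nov_mono: "A \<subseteq> B \<Longrightarrow> carrier (nov A) \<subseteq> carrier (nov B)"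
  unfolding carrier_nov by fastforce

lemma novD:
  assumes "x \<in> carrier (nov A)"
  shows "g \<in> carrier G \<Longrightarrow> x g \<in> A" "x \<in> extensional (carrier G)"
    "finite {g \<in> carrier G. x g \<noteq> 0 \<and> \<phi> g \<le> \<kappa>}"
  using assms by (auto simp: carrier_nov PiE_def)

lemma nov_cong:
  assumes "x \<in> carrier (nov A)" "y \<in> carrier (nov B)" "\<And>g. g \<in> carrier G \<Longrightarrow> x g = y g"
  shows "x = y"
  using assms novD(2) by (meson extensionalityI)

text \<open>Summing over an arbitrary finite superset of the effective index set is what lets
  several convolutions share one index set in the proofs of distributivity and
  associativity.\<close>

lemma convolution_eq:
  assumes A: "rat_subring A" and x: "x \<in> carrier G \<rightarrow> A" and y: "y \<in> carrier G \<rightarrow> A"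
    and g: "g \<in> carrier G" and B: "finite B" "B \<subseteq> carrier G"
    "{h \<in> carrier G. x h \<noteq> 0 \<and> y (inv h \<otimes> g) \<noteq> 0} \<subseteq> B"
  shows "convolution (rat_ring A) G x y g = (\<Sum>h\<in>B. x h * y (inv h \<otimes> g))"
proof -
  let ?H = "{h \<in> carrier G. x h \<noteq> 0 \<and> y (inv h \<otimes> g) \<noteq> 0}"
  have "convolution (rat_ring A) G x y g =
      finsum (rat_ring A) (\<lambda>h. x h * y (inv h \<otimes> g)) ?H"
    using g by (simp add: convolution_def rat_ring_def)
  also have "\<dots> = (\<Sum>h\<in>?H. x h * y (inv h \<otimes> g))"
    using x y g by (intro finsum_rat_ring A) (auto intro!: rat_subringD[OF A])
  also have "\<dots> = (\<Sum>h\<in>B. x h * y (inv h \<otimes> g))"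
    using B by (intro sum.mono_neutral_left) auto
  finally show ?thesis .
qed

text \<open>Only finitely many support elements have phi at most 0, so their values have a minimum.
  Inserting 0 bounds the remaining ones and covers the empty case.\<close>

lemma nov_bounded_below:
  assumes "x \<in> carrier (nov \<rat>)"
  shows "\<exists>a. x \<in> filt a"
proof -
  let ?F = "\<phi> ` {g \<in> carrier G. x g \<noteq> 0 \<and> \<phi> g \<le> 0}"
  have fin: "finite (insert 0 ?F)" using novD(3)[OF assms] by auto
  have "Min (insert 0 ?F) \<le> \<phi> g" if "g \<in> carrier G" "x g \<noteq> 0" for g
  proof (cases "\<phi> g \<le> 0")
    case True
    then show ?thesis using that fin by (intro Min_le) auto
  next
    case False
    then show ?thesis using Min_le[OF fin, of 0] by simp
  qed
  then show ?thesis using assms unfolding filt_def by blast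
qed

lemma filtD:
  assumes "x \<in> filt a"
  shows "x \<in> carrier (nov \<rat>)" "g \<in> carrier G \<Longrightarrow> x g \<noteq> 0 \<Longrightarrow> a \<le> \<phi> g"
  using assms by (auto simp: filt_def)

lemma filt_mono: "a \<le> b \<Longrightarrow> filt b \<subseteq> filt a"
  unfolding filt_def by force

text \<open>A lower bound on the support of \<open>y\<close> becomes an upper bound on phi of
  \<open>h\<close>, and there the finiteness condition on \<open>x\<close> alone makes the
  convolution sum finite.\<close>

lemma conv_support:
  assumes "y \<in> filt b" "g \<in> carrier G"
  shows "{h \<in> carrier G. x h \<noteq> 0 \<and> y (inv h \<otimes> g) \<noteq> 0}
    \<subseteq> {h \<in> carrier G. x h \<noteq> 0 \<and> \<phi> h \<le> \<phi> g - b}"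
proof safe
  fix h assume h: "h \<in> carrier G" "y (inv h \<otimes> g) \<noteq> 0"
  then have "b \<le> \<phi> (inv h \<otimes> g)" using filtD[OF assms(1)] assms(2) by simp
  then show "\<phi> h \<le> \<phi> g - b" using h assms(2) by (simp add: \<phi>_mult \<phi>_inv)
qed

lemma finite_conv_support:
  assumes "x \<in> carrier (nov \<rat>)" "y \<in> carrier (nov \<rat>)" "g \<in> carrier G"
  shows "finite {h \<in> carrier G. x h \<noteq> 0 \<and> y (inv h \<otimes> g) \<noteq> 0}"
proof -
  obtain b where b: "y \<in> filt b" using nov_bounded_below assms by blast
  show ?thesis
    by (rule finite_subset[OF conv_support[OF b assms(3)] novD(3)[OF assms(1)]])
qed

lemma conv_eq:
  assumes "x \<in> carrier (nov \<rat>)" "y \<in> carrier (nov \<rat>)"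
    and "g \<in> carrier G" and "finite B" "B \<subseteq> carrier G"
    "{h \<in> carrier G. x h \<noteq> 0 \<and> y (inv h \<otimes> g) \<noteq> 0} \<subseteq> B"
  shows "conv x y g = (\<Sum>h\<in>B. x h * y (inv h \<otimes> g))"
  using assms by (intro convolution_eq rat_subring_Rats) (auto intro: novD(1))

lemma conv_nonzero:
  assumes x: "x \<in> carrier (nov \<rat>)" and y: "y \<in> carrier (nov \<rat>)"
    and g: "g \<in> carrier G" "conv x y g \<noteq> 0"
  obtains h l where "h \<in> carrier G" "l \<in> carrier G" "g = h \<otimes> l" "x h \<noteq> 0" "y l \<noteq> 0"
proof -
  let ?H = "{h \<in> carrier G. x h \<noteq> 0 \<and> y (inv h \<otimes> g) \<noteq> 0}"
  have "(\<Sum>h\<in>?H. x h * y (inv h \<otimes> g)) \<noteq> 0"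
    using g conv_eq[OF x y g(1) finite_conv_support[OF x y g(1)]] by auto
  then obtain h where "h \<in> ?H" by (meson sum.not_neutral_contains_not_neutral)
  then show ?thesis
    using that[of h "inv h \<otimes> g"] g by (simp flip: m_assoc)
qed

text \<open>A nonzero coefficient at \<open>g\<close> comes from a factorization g = h l through
  both supports. As phi is additive and bounded below on each support, an upper bound on phi g
  bounds phi h and phi l from above, which leaves finitely many pairs.\<close>

lemma conv_in_filt:
  assumes A: "rat_subring A" "A \<subseteq> \<rat>"
    and x: "x \<in> carrier (nov A)" "x \<in> filt a" and y: "y \<in> carrier (nov A)" "y \<in> filt b"
  shows "conv x y \<in> carrier (nov A)" "conv x y \<in> filt (a + b)"
proof -
  have xy: "x \<in> carrier (nov \<rat>)" "y \<in> carrier (nov \<rat>)" using x y filtD by auto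
  have fin: "finite {g \<in> carrier G. conv x y g \<noteq> 0 \<and> \<phi> g \<le> \<kappa>}" for \<kappa>
  proof (rule finite_subset)
    let ?X = "{g \<in> carrier G. x g \<noteq> 0 \<and> \<phi> g \<le> \<kappa> - b}"
    let ?Y = "{g \<in> carrier G. y g \<noteq> 0 \<and> \<phi> g \<le> \<kappa> - a}"
    show "finite ((\<lambda>(h, l). h \<otimes> l) ` (?X \<times> ?Y))"
      using novD(3)[OF xy(1)] novD(3)[OF xy(2)] by blast
    show "{g \<in> carrier G. conv x y g \<noteq> 0 \<and> \<phi> g \<le> \<kappa>} \<subseteq> (\<lambda>(h, l). h \<otimes> l) ` (?X \<times> ?Y)"
    proof
      fix g assume g: "g \<in> {g \<in> carrier G. conv x y g \<noteq> 0 \<and> \<phi> g \<le> \<kappa>}"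
      then obtain h l where hl: "h \<in> carrier G" "l \<in> carrier G" "g = h \<otimes> l" "x h \<noteq> 0" "y l \<noteq> 0"
        using conv_nonzero[OF xy] by blast
      have "a \<le> \<phi> h" "b \<le> \<phi> l" "\<phi> h + \<phi> l \<le> \<kappa>"
        using hl g filtD(2)[OF x(2)] filtD(2)[OF y(2)] by (auto simp: \<phi>_mult)
      then show "g \<in> (\<lambda>(h, l). h \<otimes> l) ` (?X \<times> ?Y)"
        using hl by (intro image_eqI[of _ _ "(h, l)"]) auto
    qed
  qed
  have "conv x y g \<in> A" if g: "g \<in> carrier G" for g
    using conv_eq[OF xy g finite_conv_support[OF xy g]] novD(1)[OF x(1)] novD(1)[OF y(1)] g
    by (auto intro!: sum_in_rat_subring rat_subringD A)
  moreover have "conv x y \<in> extensional (carrier G)"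
    by (simp add: convolution_def)
  ultimately show *: "conv x y \<in> carrier (nov A)"
    using fin by (auto simp: carrier_nov PiE_def)
  have "a + b \<le> \<phi> g" if "g \<in> carrier G" "conv x y g \<noteq> 0" for g
    using conv_nonzero[OF xy that] filtD(2)[OF x(2)] filtD(2)[OF y(2)] by (metis \<phi>_mult add_mono)
  then show "conv x y \<in> filt (a + b)"
    using * nov_mono[OF A(2)] unfolding filt_def by blast
qed

lemma conv_closed:
  assumes "rat_subring A" "A \<subseteq> \<rat>" "x \<in> carrier (nov A)" "y \<in> carrier (nov A)"
  shows "conv x y \<in> carrier (nov A)"
  using assms conv_in_filt(1) nov_bounded_below nov_mono by (meson subsetD)

lemma convolution_eq_conv:
  assumes A: "rat_subring A" "A \<subseteq> \<rat>" and x: "x \<in> carrier (nov A)" and y: "y \<in> carrier (nov A)"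
  shows "convolution (rat_ring A) G x y = conv x y"
proof
  fix g
  have xy: "x \<in> carrier (nov \<rat>)" "y \<in> carrier (nov \<rat>)" using x y nov_mono[OF A(2)] by auto
  show "convolution (rat_ring A) G x y g = conv x y g"
  proof (cases "g \<in> carrier G")
    case True
    note fin = finite_conv_support[OF xy True]
    show ?thesis
      using conv_eq[OF xy True fin] convolution_eq[OF A(1) _ _ True fin] novD(1)[OF x] novD(1)[OF y]
      by auto
  qed (simp add: convolution_def)
qed

lemma conv_assoc:
  assumes x: "x \<in> carrier (nov \<rat>)" and y: "y \<in> carrier (nov \<rat>)" and z: "z \<in> carrier (nov \<rat>)"
  shows "conv (conv x y) z = conv x (conv y z)"
proof
  fix g
  note Q = rat_subring_Rats order_refl
  have xy: "conv x y \<in> carrier (nov \<rat>)" and yz: "conv y z \<in> carrier (nov \<rat>)"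
    using conv_closed[OF Q] x y z by auto
  show "conv (conv x y) z g = conv x (conv y z) g"
  proof (cases "g \<in> carrier G")
    case g: True
    obtain b c where b: "y \<in> filt b" and c: "z \<in> filt c" using nov_bounded_below y z by blast
    \<comment> \<open>A bound on phi replaces the exact support, so that one set works for every
      \<open>k\<close> in the inner sums and for the final convolution.\<close>
    define A where "A = {h \<in> carrier G. x h \<noteq> 0 \<and> \<phi> h \<le> \<phi> g - (b + c)}"
    \<comment> \<open>The first part serves the outer convolution at \<open>g\<close>. The second
      contains the products h l that the inner one needs, so that substituting k = h l for fixed
      \<open>h\<close> stays inside \<open>B\<close>.\<close>
    define B where "B = {k \<in> carrier G. conv x y k \<noteq> 0 \<and> z (inv k \<otimes> g) \<noteq> 0} \<union>
      (\<Union>h\<in>A. (\<lambda>l. h \<otimes> l) ` {l \<in> carrier G. y l \<noteq> 0 \<and> z (inv l \<otimes> (inv h \<otimes> g)) \<noteq> 0})"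
    have A: "finite A" "A \<subseteq> carrier G" using novD(3)[OF x] by (auto simp: A_def)
    have B: "finite B" "B \<subseteq> carrier G"
      using finite_conv_support[OF xy z g] A finite_conv_support[OF y z] g by (auto simp: B_def)
    have BA: "conv x y k * z (inv k \<otimes> g) = (\<Sum>h\<in>A. x h * y (inv h \<otimes> k)) * z (inv k \<otimes> g)"
      if k: "k \<in> B" for k
    proof (cases "z (inv k \<otimes> g) = 0")
      case False
      have kG: "k \<in> carrier G" using k B by auto
      \<comment> \<open>Only the bound on phi k is wanted; the constant function 1 fills the place
        of the left factor.\<close>
      have "k \<in> {h \<in> carrier G. 1 \<noteq> (0::nat) \<and> \<phi> h \<le> \<phi> g - c}"
        using conv_support[OF c g, of "\<lambda>_. 1"] kG False by auto
      then have "{h \<in> carrier G. x h \<noteq> 0 \<and> y (inv h \<otimes> k) \<noteq> 0} \<subseteq> A"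
        using conv_support[OF b kG, of x] unfolding A_def by force
      then show ?thesis using conv_eq[OF x y kG A] by simp
    qed simp
    have "conv (conv x y) z g = (\<Sum>k\<in>B. conv x y k * z (inv k \<otimes> g))"
      by (intro conv_eq xy z g B) (auto simp: B_def)
    also have "\<dots> = (\<Sum>k\<in>B. \<Sum>h\<in>A. x h * (y (inv h \<otimes> k) * z (inv k \<otimes> g)))"
      using BA by (simp add: sum_distrib_right mult.assoc)
    also have "\<dots> = (\<Sum>h\<in>A. x h * (\<Sum>k\<in>B. y (inv h \<otimes> k) * z (inv k \<otimes> g)))"
      by (subst sum.swap) (simp add: sum_distrib_left)
    also have "\<dots> = (\<Sum>h\<in>A. x h * conv y z (inv h \<otimes> g))"
    proof (rule sum.cong[OF refl])
      fix h assume h: "h \<in> A"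
      then have hG: "h \<in> carrier G" using A by auto
      have inj: "inj_on (\<lambda>k. inv h \<otimes> k) B"
        using hG B by (intro inj_onI) (metis Units_eq Units_l_cancel inv_closed subsetD)
      have "conv y z (inv h \<otimes> g) =
          (\<Sum>l\<in>(\<lambda>k. inv h \<otimes> k) ` B. y l * z (inv l \<otimes> (inv h \<otimes> g)))"
      proof (rule conv_eq[OF y z])
        show "{l \<in> carrier G. y l \<noteq> 0 \<and> z (inv l \<otimes> (inv h \<otimes> g)) \<noteq> 0} \<subseteq> (\<lambda>k. inv h \<otimes> k) ` B"
        proof
          fix l assume l: "l \<in> {l \<in> carrier G. y l \<noteq> 0 \<and> z (inv l \<otimes> (inv h \<otimes> g)) \<noteq> 0}"
          then have "h \<otimes> l \<in> B" using h by (auto simp: B_def)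
          moreover have "l = inv h \<otimes> (h \<otimes> l)" using l hG by (simp flip: m_assoc)
          ultimately show "l \<in> (\<lambda>k. inv h \<otimes> k) ` B" by blast
        qed
      qed (use hG g B in auto)
      also have "\<dots> = (\<Sum>k\<in>B. y (inv h \<otimes> k) * z (inv k \<otimes> g))"
      proof -
        have "inv (inv h \<otimes> k) \<otimes> (inv h \<otimes> g) = inv k \<otimes> g" if "k \<in> B" for k
        proof -
          have k: "k \<in> carrier G" using that B by auto
          have "h \<otimes> (inv h \<otimes> g) = g" using hG g by (simp flip: m_assoc)
          then show ?thesis using hG g k by (simp add: inv_mult_group m_assoc)
        qed
        then show ?thesis by (simp add: sum.reindex[OF inj])
      qed
      finally show "x h * (\<Sum>k\<in>B. y (inv h \<otimes> k) * z (inv k \<otimes> g)) = x h * conv y z (inv h \<otimes> g)"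
        by simp
    qed
    also have "\<dots> = conv x (conv y z) g"
    proof (rule conv_eq[OF x yz g A, symmetric])
      have "conv y z \<in> filt (b + c)" using conv_in_filt(2)[OF Q y b z c] .
      then show "{h \<in> carrier G. x h \<noteq> 0 \<and> conv y z (inv h \<otimes> g) \<noteq> 0} \<subseteq> A"
        using conv_support g unfolding A_def by blast
    qed
    finally show ?thesis .
  qed (simp add: convolution_def)
qed

section \<open>Ring structure of the Novikov rings\<close>

lemma nov_add_closed:
  assumes A: "rat_subring A" and x: "x \<in> carrier (nov A)" and y: "y \<in> carrier (nov A)"
  shows "(\<lambda>g\<in>carrier G. x g + y g) \<in> carrier (nov A)"
proof -
  have "finite {g \<in> carrier G. x g + y g \<noteq> 0 \<and> \<phi> g \<le> \<kappa>}" for \<kappa>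
    by (rule finite_subset[OF _ finite_UnI[OF novD(3)[OF x, of \<kappa>] novD(3)[OF y, of \<kappa>]]]) auto
  then show ?thesis
    using novD(1)[OF x] novD(1)[OF y] rat_subringD(3)[OF A]
    by (auto simp: carrier_nov cong: conj_cong)
qed

lemma nov_uminus_closed:
  assumes A: "rat_subring A" and x: "x \<in> carrier (nov A)"
  shows "(\<lambda>g\<in>carrier G. - x g) \<in> carrier (nov A)"
  using novD(1)[OF x] novD(3)[OF x] rat_subringD(5)[OF A]
  by (auto simp: carrier_nov cong: conj_cong)

lemma nov_const_closed:
  assumes A: "rat_subring A"
  shows "\<zero>\<^bsub>nov A\<^esub> \<in> carrier (nov A)" "\<one>\<^bsub>nov A\<^esub> \<in> carrier (nov A)"
proof -
  show "\<zero>\<^bsub>nov A\<^esub> \<in> carrier (nov A)"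
    using rat_subringD(1)[OF A] by (auto simp: nov_sel carrier_nov cong: conj_cong)
  have "finite {g \<in> carrier G. (if g = \<one> then 1 else 0) \<noteq> (0::rat) \<and> \<phi> g \<le> \<kappa>}" for \<kappa>
    by (rule finite_subset[of _ "{\<one>}"]) auto
  then show "\<one>\<^bsub>nov A\<^esub> \<in> carrier (nov A)"
    using rat_subringD(1,2)[OF A] by (auto simp: nov_sel carrier_nov cong: conj_cong)
qed

lemma conv_add_left:
  assumes x: "x \<in> carrier (nov \<rat>)" and y: "y \<in> carrier (nov \<rat>)" and z: "z \<in> carrier (nov \<rat>)"
    and g: "g \<in> carrier G"
  shows "conv (\<lambda>g\<in>carrier G. x g + y g) z g = conv x z g + conv y z g"
proof -
  define B where "B = {h \<in> carrier G. x h \<noteq> 0 \<and> z (inv h \<otimes> g) \<noteq> 0} \<union>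
    {h \<in> carrier G. y h \<noteq> 0 \<and> z (inv h \<otimes> g) \<noteq> 0}"
  have B: "finite B" "B \<subseteq> carrier G" using finite_conv_support x y z g by (auto simp: B_def)
  have "conv (\<lambda>g\<in>carrier G. x g + y g) z g =
      (\<Sum>h\<in>B. (\<lambda>g\<in>carrier G. x g + y g) h * z (inv h \<otimes> g))"
    by (rule conv_eq[OF nov_add_closed[OF rat_subring_Rats x y] z g B]) (auto simp: B_def)
  also have "\<dots> = (\<Sum>h\<in>B. x h * z (inv h \<otimes> g)) + (\<Sum>h\<in>B. y h * z (inv h \<otimes> g))"
    using B by (subst sum.distrib[symmetric]) (auto intro!: sum.cong simp: distrib_right)
  also have "\<dots> = conv x z g + conv y z g"
    using conv_eq[OF x z g B] conv_eq[OF y z g B] by (simp add: B_def)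
  finally show ?thesis .
qed

lemma conv_add_right:
  assumes x: "x \<in> carrier (nov \<rat>)" and y: "y \<in> carrier (nov \<rat>)" and z: "z \<in> carrier (nov \<rat>)"
    and g: "g \<in> carrier G"
  shows "conv z (\<lambda>g\<in>carrier G. x g + y g) g = conv z x g + conv z y g"
proof -
  define B where "B = {h \<in> carrier G. z h \<noteq> 0 \<and> x (inv h \<otimes> g) \<noteq> 0} \<union>
    {h \<in> carrier G. z h \<noteq> 0 \<and> y (inv h \<otimes> g) \<noteq> 0}"
  have B: "finite B" "B \<subseteq> carrier G" using finite_conv_support x y z g by (auto simp: B_def)
  have "conv z (\<lambda>g\<in>carrier G. x g + y g) g =
      (\<Sum>h\<in>B. z h * (\<lambda>g\<in>carrier G. x g + y g) (inv h \<otimes> g))"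
    by (rule conv_eq[OF z nov_add_closed[OF rat_subring_Rats x y] g B]) (use g in \<open>auto simp: B_def\<close>)
  also have "\<dots> = (\<Sum>h\<in>B. z h * x (inv h \<otimes> g)) + (\<Sum>h\<in>B. z h * y (inv h \<otimes> g))"
    using B g by (subst sum.distrib[symmetric]) (auto intro!: sum.cong simp: distrib_left)
  also have "\<dots> = conv z x g + conv z y g"
    using conv_eq[OF z x g B] conv_eq[OF z y g B] by (simp add: B_def)
  finally show ?thesis .
qed

text \<open>The ring laws are checked for rational coefficients only; the Novikov rings over smaller
  coefficient rings enter as subrings of this one, by \<open>subring_nov\<close>.\<close>

lemma nov_ring: "ring (nov \<rat>)"
proof (rule ringI)
  note Q = rat_subring_Rats order_refl
  note closed = nov_add_closed[OF Q(1)] nov_uminus_closed[OF Q(1)] nov_const_closed[OF Q(1)]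
    conv_closed[OF Q]
  show "abelian_group (nov \<rat>)"
  proof (rule abelian_groupI)
    fix x y z assume *: "x \<in> carrier (nov \<rat>)" "y \<in> carrier (nov \<rat>)" "z \<in> carrier (nov \<rat>)"
    show "x \<oplus>\<^bsub>nov \<rat>\<^esub> y \<in> carrier (nov \<rat>)" using * closed by (simp add: nov_sel)
    show "x \<oplus>\<^bsub>nov \<rat>\<^esub> y \<oplus>\<^bsub>nov \<rat>\<^esub> z = x \<oplus>\<^bsub>nov \<rat>\<^esub> (y \<oplus>\<^bsub>nov \<rat>\<^esub> z)"
      by (auto simp: nov_sel)
    show "x \<oplus>\<^bsub>nov \<rat>\<^esub> y = y \<oplus>\<^bsub>nov \<rat>\<^esub> x" by (auto simp: nov_sel)
    show "\<zero>\<^bsub>nov \<rat>\<^esub> \<oplus>\<^bsub>nov \<rat>\<^esub> x = x"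
      by (rule nov_cong[of _ \<rat>, OF _ *(1)])
        (use * closed(1)[OF closed(3) *(1)] in \<open>auto simp: nov_sel\<close>)
    show "\<exists>y\<in>carrier (nov \<rat>). y \<oplus>\<^bsub>nov \<rat>\<^esub> x = \<zero>\<^bsub>nov \<rat>\<^esub>"
      using closed(2)[OF *(1)] by (intro bexI[of _ "\<lambda>g\<in>carrier G. - x g"]) (auto simp: nov_sel)
  qed (use closed in auto)
  show "monoid (nov \<rat>)"
  proof (rule monoidI)
    fix x assume x: "x \<in> carrier (nov \<rat>)"
    have one: "\<one>\<^bsub>nov \<rat>\<^esub> \<in> carrier (nov \<rat>)" by (rule closed)
    show "\<one>\<^bsub>nov \<rat>\<^esub> \<otimes>\<^bsub>nov \<rat>\<^esub> x = x"
    proof (rule nov_cong[OF _ x])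
      fix g assume g: "g \<in> carrier G"
      have "conv \<one>\<^bsub>nov \<rat>\<^esub> x g = (\<Sum>h\<in>{\<one>}. \<one>\<^bsub>nov \<rat>\<^esub> h * x (inv h \<otimes> g))"
        by (rule conv_eq[OF one x g]) (auto simp: nov_sel split: if_splits)
      then show "(\<one>\<^bsub>nov \<rat>\<^esub> \<otimes>\<^bsub>nov \<rat>\<^esub> x) g = x g" using g by (simp add: nov_sel)
    qed (use x one closed in \<open>simp add: nov_sel(4)\<close>)
    show "x \<otimes>\<^bsub>nov \<rat>\<^esub> \<one>\<^bsub>nov \<rat>\<^esub> = x"
    proof (rule nov_cong[OF _ x])
      fix g assume g: "g \<in> carrier G"
      have "conv x \<one>\<^bsub>nov \<rat>\<^esub> g = (\<Sum>h\<in>{g}. x h * \<one>\<^bsub>nov \<rat>\<^esub> (inv h \<otimes> g))"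
      proof (rule conv_eq[OF x one g])
        have "h = g" if "h \<in> carrier G" "inv h \<otimes> g = \<one>" for h
          using that g inv_solve_left[of \<one> h g] by simp
        then show "{h \<in> carrier G. x h \<noteq> 0 \<and> \<one>\<^bsub>nov \<rat>\<^esub> (inv h \<otimes> g) \<noteq> 0} \<subseteq> {g}"
          using g by (auto simp: nov_sel split: if_splits)
      qed (use g in auto)
      then show "(x \<otimes>\<^bsub>nov \<rat>\<^esub> \<one>\<^bsub>nov \<rat>\<^esub>) g = x g" using g by (simp add: nov_sel)
    qed (use x one closed in \<open>simp add: nov_sel(4)\<close>)
  qed (use closed conv_assoc in \<open>simp_all add: nov_sel(4)\<close>)
  fix x y z assume *: "x \<in> carrier (nov \<rat>)" "y \<in> carrier (nov \<rat>)" "z \<in> carrier (nov \<rat>)"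
  note xy = closed(1)[OF *(1,2)]
  show "(x \<oplus>\<^bsub>nov \<rat>\<^esub> y) \<otimes>\<^bsub>nov \<rat>\<^esub> z = x \<otimes>\<^bsub>nov \<rat>\<^esub> z \<oplus>\<^bsub>nov \<rat>\<^esub> y \<otimes>\<^bsub>nov \<rat>\<^esub> z"
    unfolding nov_sel
    by (rule nov_cong[OF conv_closed[OF Q xy *(3)] nov_add_closed[OF Q(1) conv_closed[OF Q] conv_closed[OF Q]]])
      (use * conv_add_left in auto)
  show "z \<otimes>\<^bsub>nov \<rat>\<^esub> (x \<oplus>\<^bsub>nov \<rat>\<^esub> y) = z \<otimes>\<^bsub>nov \<rat>\<^esub> x \<oplus>\<^bsub>nov \<rat>\<^esub> z \<otimes>\<^bsub>nov \<rat>\<^esub> y"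
    unfolding nov_sel
    by (rule nov_cong[OF conv_closed[OF Q *(3) xy] nov_add_closed[OF Q(1) conv_closed[OF Q] conv_closed[OF Q]]])
      (use * conv_add_right in auto)
qed

lemma a_inv_nov:
  assumes "x \<in> carrier (nov \<rat>)"
  shows "\<ominus>\<^bsub>nov \<rat>\<^esub> x = (\<lambda>g\<in>carrier G. - x g)"
proof -
  interpret N: ring "nov \<rat>" by (rule nov_ring)
  have "(\<lambda>g\<in>carrier G. - x g) \<oplus>\<^bsub>nov \<rat>\<^esub> x = \<zero>\<^bsub>nov \<rat>\<^esub>"
    by (auto simp: nov_sel)
  then show ?thesis
    using assms nov_uminus_closed[OF rat_subring_Rats assms] N.minus_equality by blast
qed

lemma subring_nov:
  assumes A: "rat_subring A" "A \<subseteq> \<rat>"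
  shows "subring (carrier (nov A)) (nov \<rat>)"
proof -
  interpret N: ring "nov \<rat>" by (rule nov_ring)
  show ?thesis
  proof (rule ring.subringI[OF nov_ring])
    show "carrier (nov A) \<subseteq> carrier (nov \<rat>)" using nov_mono[OF A(2)] .
    show "\<one>\<^bsub>nov \<rat>\<^esub> \<in> carrier (nov A)"
      using nov_const_closed(2)[OF A(1)] by (simp add: nov_sel)
    fix x y assume x: "x \<in> carrier (nov A)" and y: "y \<in> carrier (nov A)"
    show "\<ominus>\<^bsub>nov \<rat>\<^esub> x \<in> carrier (nov A)"
      using x nov_mono[OF A(2)] nov_uminus_closed[OF A(1) x] a_inv_nov by auto
    show "x \<otimes>\<^bsub>nov \<rat>\<^esub> y \<in> carrier (nov A)"
      using conv_closed[OF A x y] by (simp add: nov_sel)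
    show "x \<oplus>\<^bsub>nov \<rat>\<^esub> y \<in> carrier (nov A)"
      using nov_add_closed[OF A(1) x y] by (simp add: nov_sel)
  qed
qed

section \<open>The topology given by the filtration\<close>

lemma filt_mult: "x \<in> filt a \<Longrightarrow> y \<in> filt b \<Longrightarrow> x \<otimes>\<^bsub>nov \<rat>\<^esub> y \<in> filt (a + b)"
  using conv_in_filt(2)[OF rat_subring_Rats order_refl _ _ _ _] filtD(1) by (simp add: nov_sel)

lemma minus_nov:
  assumes "x \<in> carrier (nov \<rat>)" "y \<in> carrier (nov \<rat>)"
  shows "x \<ominus>\<^bsub>nov \<rat>\<^esub> y = (\<lambda>g\<in>carrier G. x g - y g)"
  using assms by (auto simp: a_minus_def a_inv_nov nov_sel)

lemma filt_minus:
  assumes "x \<in> filt a" "y \<in> filt a"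
  shows "x \<ominus>\<^bsub>nov \<rat>\<^esub> y \<in> filt a"
proof -
  interpret N: ring "nov \<rat>" by (rule nov_ring)
  have "x \<ominus>\<^bsub>nov \<rat>\<^esub> y = (\<lambda>g\<in>carrier G. x g - y g)"
    using minus_nov[OF filtD(1)[OF assms(1)] filtD(1)[OF assms(2)]] .
  moreover have "x \<ominus>\<^bsub>nov \<rat>\<^esub> y \<in> carrier (nov \<rat>)" using assms filtD(1) by auto
  ultimately show ?thesis
    using filtD(2)[OF assms(1)] filtD(2)[OF assms(2)] unfolding filt_def by force
qed

lemma filt_zero: "\<zero>\<^bsub>nov \<rat>\<^esub> \<in> filt a"
  using nov_const_closed[OF rat_subring_Rats] by (simp add: filt_def) (simp add: nov_sel)

lemma filt_add:
  assumes "x \<in> filt a" "y \<in> filt a"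
  shows "x \<oplus>\<^bsub>nov \<rat>\<^esub> y \<in> filt a"
proof -
  interpret N: ring "nov \<rat>" by (rule nov_ring)
  have "x \<ominus>\<^bsub>nov \<rat>\<^esub> (\<zero>\<^bsub>nov \<rat>\<^esub> \<ominus>\<^bsub>nov \<rat>\<^esub> y) \<in> filt a"
    by (intro filt_minus filt_zero assms)
  then show ?thesis using assms filtD(1) by (simp add: N.minus_eq)
qed

lemma filt_finsum:
  assumes "\<And>x. x \<in> X \<Longrightarrow> f x \<in> filt a"
  shows "finsum (nov \<rat>) f X \<in> filt a"
proof -
  interpret N: ring "nov \<rat>" by (rule nov_ring)
  show ?thesis using assms
  proof (induction X rule: infinite_finite_induct)
    case (insert x X)
    then have "f \<in> X \<rightarrow> carrier (nov \<rat>)" "f x \<in> carrier (nov \<rat>)" using filtD(1) by auto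
    then show ?case using insert by (simp add: filt_add)
  qed (simp_all add: filt_zero)
qed

text \<open>At a fixed \<open>g\<close> some level a + n exceeds phi g. Equations in the Novikov
  ring can therefore be checked modulo every level.\<close>

lemma filt_separated:
  assumes "\<And>n::nat. x \<in> filt (a + real n)"
  shows "x = \<zero>\<^bsub>nov \<rat>\<^esub>"
proof (rule nov_cong)
  show "x \<in> carrier (nov \<rat>)" using filtD(1)[OF assms[of 0]] .
  show "\<zero>\<^bsub>nov \<rat>\<^esub> \<in> carrier (nov \<rat>)" by (rule nov_const_closed[OF rat_subring_Rats])
  fix g assume g: "g \<in> carrier G"
  obtain n :: nat where "\<phi> g - a < real n" using reals_Archimedean2 by blast
  then have "x g = 0" using filtD(2)[OF assms[of n] g] by force
  then show "x g = \<zero>\<^bsub>nov \<rat>\<^esub> g" using g by (simp add: nov_sel)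
qed

text \<open>Up to level \<open>a\<close> there are finitely many nonzero coefficients, hence
  finitely many denominators; what is cut off lies in \<open>filt a\<close>.\<close>

lemma truncation:
  assumes x: "x \<in> carrier (nov \<rat>)"
  shows "\<exists>P y. finite P \<and> (\<forall>p\<in>P. prime p) \<and> y \<in> carrier (nov (localized_ints P)) \<and>
    x \<ominus>\<^bsub>nov \<rat>\<^esub> y \<in> filt a"
proof -
  let ?F = "{g \<in> carrier G. x g \<noteq> 0 \<and> \<phi> g \<le> a}"
  have fin: "finite ?F" using novD(3)[OF x] .
  obtain P where P: "finite P" "\<forall>p\<in>P. prime p" "x ` ?F \<subseteq> localized_ints P"
    using finite_rats_localized[of "x ` ?F"] fin by auto
  define y where "y = (\<lambda>g\<in>carrier G. if x g \<noteq> 0 \<and> \<phi> g \<le> a then x g else 0)"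
  have "finite {g \<in> carrier G. y g \<noteq> 0 \<and> \<phi> g \<le> \<kappa>}" for \<kappa>
    by (rule finite_subset[OF _ fin]) (auto simp: y_def split: if_splits)
  then have y: "y \<in> carrier (nov (localized_ints P))"
    using P(3)[unfolded image_subset_iff] rat_subringD(1)[OF rat_subring_localized_ints]
    by (auto simp: carrier_nov y_def)
  then have yQ: "y \<in> carrier (nov \<rat>)" using nov_mono[OF localized_ints_subset_Rats] by blast
  have "x \<ominus>\<^bsub>nov \<rat>\<^esub> y \<in> carrier (nov \<rat>)"
    using x yQ nov_ring by (simp add: ring.ring_simprules)
  then have "x \<ominus>\<^bsub>nov \<rat>\<^esub> y \<in> filt a"
    using minus_nov[OF x yQ] by (auto simp: filt_def y_def split: if_splits)
  then show ?thesis using P y by blast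
qed

text \<open>The sum of the \<open>w n\<close> is formed coefficientwise. Below any level only
  finitely many terms contribute, so each coefficient is a finite sum of elements of
  \<open>A\<close> and no new denominators appear.\<close>

lemma filt_complete:
  assumes A: "rat_subring A" "A \<subseteq> \<rat>"
    and w: "\<And>n. w n \<in> carrier (nov A)" "\<And>n. w n \<in> filt (a + real n)"
  shows "\<exists>u\<in>carrier (nov A). \<forall>m. u \<ominus>\<^bsub>nov \<rat>\<^esub> finsum (nov \<rat>) w {..<m} \<in> filt (a + real m)"
proof -
  interpret N: ring "nov \<rat>" by (rule nov_ring)
  have wQ: "w n \<in> carrier (nov \<rat>)" for n using w filtD by blast
  have fs: "finsum (nov \<rat>) w {..<m} g = (\<Sum>n<m. w n g)" if "g \<in> carrier G" for m g
    using that wQ by (induction m) (auto simp: lessThan_Suc nov_sel)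
  \<comment> \<open>The added 1 makes the cutoff strictly larger than kappa - a, so that a + n
    exceeds kappa from that index on.\<close>
  define K where "K \<kappa> = nat \<lceil>\<kappa> - a\<rceil> + 1" for \<kappa>
  have van: "w n g = 0" if "g \<in> carrier G" "\<phi> g \<le> \<kappa>" "n \<ge> K \<kappa>" for n g \<kappa>
  proof (rule ccontr)
    assume "w n g \<noteq> 0"
    then have "a + real n \<le> \<phi> g" using filtD(2)[OF w(2)] that by auto
    then show False using that unfolding K_def by linarith
  qed
  define u where "u = (\<lambda>g\<in>carrier G. \<Sum>n<K (\<phi> g). w n g)"
  \<comment> \<open>Each coefficient of \<open>u\<close> has its own cutoff; finiteness of the
    support below kappa and comparison with partial sums need a common one.\<close>
  have u_eq: "u g = (\<Sum>n<m. w n g)" if "g \<in> carrier G" "\<phi> g \<le> \<kappa>" "m \<ge> K \<kappa>" for g m \<kappa>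
  proof -
    have "K (\<phi> g) \<le> K \<kappa>" 
      unfolding K_def using that(2) by (intro add_mono nat_mono ceiling_mono) auto
    then have "(\<Sum>n<m. w n g) = (\<Sum>n<K (\<phi> g). w n g)"
      using that van[OF that(1) order_refl] by (intro sum.mono_neutral_right) auto
    then show ?thesis using that by (simp add: u_def)
  qed
  have "finite {g \<in> carrier G. u g \<noteq> 0 \<and> \<phi> g \<le> \<kappa>}" for \<kappa>
  proof (rule finite_subset)
    show "finite (\<Union>n<K \<kappa>. {g \<in> carrier G. w n g \<noteq> 0 \<and> \<phi> g \<le> \<kappa>})"
      using novD(3)[OF wQ] by blast
    show "{g \<in> carrier G. u g \<noteq> 0 \<and> \<phi> g \<le> \<kappa>} \<subseteq>
        (\<Union>n<K \<kappa>. {g \<in> carrier G. w n g \<noteq> 0 \<and> \<phi> g \<le> \<kappa>})"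
    proof clarify
      fix g assume g: "g \<in> carrier G" "u g \<noteq> 0" "\<phi> g \<le> \<kappa>"
      then have "(\<Sum>n<K \<kappa>. w n g) \<noteq> 0" using u_eq[OF g(1,3) order_refl] by simp
      then obtain n where "n < K \<kappa>" "w n g \<noteq> 0"
        by (meson lessThan_iff sum.not_neutral_contains_not_neutral)
      then show "g \<in> (\<Union>n<K \<kappa>. {g \<in> carrier G. w n g \<noteq> 0 \<and> \<phi> g \<le> \<kappa>})" using g by auto
    qed
  qed
  moreover have "u g \<in> A" if "g \<in> carrier G" for g
    using that novD(1)[OF w(1)] by (auto simp: u_def intro!: sum_in_rat_subring A)
  ultimately have u: "u \<in> carrier (nov A)" by (auto simp: carrier_nov u_def)
  then have uQ: "u \<in> carrier (nov \<rat>)" using nov_mono[OF A(2)] by blast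
  have "u \<ominus>\<^bsub>nov \<rat>\<^esub> finsum (nov \<rat>) w {..<m} \<in> filt (a + real m)" for m
  proof -
    have s: "finsum (nov \<rat>) w {..<m} \<in> carrier (nov \<rat>)" using wQ by auto
    have "a + real m \<le> \<phi> g" if g: "g \<in> carrier G" and ne: "u g - (\<Sum>n<m. w n g) \<noteq> 0" for g
    proof (rule ccontr)
      assume lt: "\<not> a + real m \<le> \<phi> g"
      have "w n g = 0" if "n \<ge> m" for n
        using filtD(2)[OF w(2)[of n] g] lt that by force
      moreover define M where "M = max m (K (\<phi> g))"
      ultimately have "(\<Sum>n<M. w n g) = (\<Sum>n<m. w n g)"
        by (intro sum.mono_neutral_right) auto
      moreover have "u g = (\<Sum>n<M. w n g)" using u_eq[OF g order_refl] by (simp add: M_def)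
      ultimately show False using ne by simp
    qed
    then show ?thesis
      using uQ s minus_nov[OF uQ s] N.minus_closed[OF uQ s] fs by (auto simp: filt_def)
  qed
  then show ?thesis using u by blast
qed

end

subsection \<open>Matrices over a ring and split exactness\<close>

context ring
begin

definition vecmat :: "'i set \<Rightarrow> ('i \<Rightarrow> 'a) \<Rightarrow> ('i \<Rightarrow> 'j \<Rightarrow> 'a) \<Rightarrow> 'j \<Rightarrow> 'a"
  where "vecmat X v A = (\<lambda>y. \<Oplus>x\<in>X. v x \<otimes> A x y)"

lemma finsum_swap:
  assumes "finite A" "finite B" "\<And>i j. i \<in> A \<Longrightarrow> j \<in> B \<Longrightarrow> f i j \<in> carrier R"
  shows "(\<Oplus>i\<in>A. \<Oplus>j\<in>B. f i j) = (\<Oplus>j\<in>B. \<Oplus>i\<in>A. f i j)"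
  using assms(1,3)
proof (induction A)
  case (insert a A)
  have "(\<Oplus>j\<in>B. f a j) \<in> carrier R" using insert.prems by (intro finsum_closed) auto
  moreover have "(\<lambda>i. \<Oplus>j\<in>B. f i j) \<in> A \<rightarrow> carrier R"
    using insert.prems by (intro Pi_I finsum_closed) auto
  ultimately have "(\<Oplus>i\<in>insert a A. \<Oplus>j\<in>B. f i j) = (\<Oplus>j\<in>B. f a j) \<oplus> (\<Oplus>j\<in>B. \<Oplus>i\<in>A. f i j)"
    using insert by simp
  also have "\<dots> = (\<Oplus>j\<in>B. f a j \<oplus> (\<Oplus>i\<in>A. f i j))"
    using insert.prems by (intro finsum_addf[symmetric] Pi_I finsum_closed) auto
  also have "\<dots> = (\<Oplus>j\<in>B. \<Oplus>i\<in>insert a A. f i j)"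
    using insert by (intro finsum_cong') (auto intro!: finsum_closed)
  finally show ?case .
qed simp

lemma vecmat_closed_subring:
  assumes T: "subring T R" and "\<And>x. x \<in> X \<Longrightarrow> v x \<in> T" "\<And>x. x \<in> X \<Longrightarrow> A x y \<in> T"
  shows "vecmat X v A y \<in> T"
proof -
  have "(\<Oplus>x\<in>X. f x) \<in> T" if "\<And>x. x \<in> X \<Longrightarrow> f x \<in> T" for f
    using that
  proof (induction X rule: infinite_finite_induct)
    case (insert x X)
    then have "f \<in> X \<rightarrow> carrier R" "f x \<in> carrier R" using subringE(1)[OF T] by auto
    then show ?case using insert subringE(7)[OF T] by simp
  qed (use subringE(2)[OF T] in auto)
  then show ?thesis using assms subringE(6)[OF T] by (simp add: vecmat_def)
qed

lemma vecmat_closed: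
  assumes "\<And>x. x \<in> X \<Longrightarrow> v x \<in> carrier R" "\<And>x. x \<in> X \<Longrightarrow> A x y \<in> carrier R"
  shows "vecmat X v A y \<in> carrier R"
  using assms by (auto simp: vecmat_def intro!: finsum_closed)

lemma vecmat_cong:
  assumes "\<And>x. x \<in> X \<Longrightarrow> v x = v' x" "\<And>x. x \<in> X \<Longrightarrow> A x = A' x"
    and "\<And>x. x \<in> X \<Longrightarrow> v' x \<in> carrier R" "\<And>x y. x \<in> X \<Longrightarrow> A' x y \<in> carrier R"
  shows "vecmat X v A = vecmat X v' A'"
  unfolding vecmat_def using assms by (intro ext finsum_cong') auto

lemma vecmat_assoc:
  assumes "finite X" "finite Y" and v: "\<And>x. x \<in> X \<Longrightarrow> v x \<in> carrier R"
    and A: "\<And>x y. x \<in> X \<Longrightarrow> A x y \<in> carrier R" and B: "\<And>y z. y \<in> Y \<Longrightarrow> B y z \<in> carrier R"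
  shows "vecmat Y (vecmat X v A) B = vecmat X v (\<lambda>x. vecmat Y (A x) B)"
proof
  fix z
  have "vecmat Y (vecmat X v A) B z = (\<Oplus>y\<in>Y. \<Oplus>x\<in>X. v x \<otimes> A x y \<otimes> B y z)"
    unfolding vecmat_def using assms
    by (intro finsum_cong') (auto intro!: finsum_ldistr finsum_closed)
  also have "\<dots> = (\<Oplus>x\<in>X. \<Oplus>y\<in>Y. v x \<otimes> A x y \<otimes> B y z)"
    using assms by (intro finsum_swap) auto
  also have "\<dots> = vecmat X v (\<lambda>x. vecmat Y (A x) B) z"
    unfolding vecmat_def using assms
    by (intro finsum_cong') (auto simp: finsum_rdistr m_assoc Pi_def intro!: finsum_closed finsum_cong')
  finally show "vecmat Y (vecmat X v A) B z = vecmat X v (\<lambda>x. vecmat Y (A x) B) z" .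
qed

lemma vecmat_add_left:
  assumes "\<And>x. x \<in> X \<Longrightarrow> v x \<in> carrier R" "\<And>x. x \<in> X \<Longrightarrow> w x \<in> carrier R"
    "\<And>x. x \<in> X \<Longrightarrow> A x y \<in> carrier R"
  shows "vecmat X (\<lambda>x. v x \<oplus> w x) A y = vecmat X v A y \<oplus> vecmat X w A y"
proof -
  have "vecmat X (\<lambda>x. v x \<oplus> w x) A y = (\<Oplus>x\<in>X. v x \<otimes> A x y \<oplus> w x \<otimes> A x y)"
    unfolding vecmat_def using assms by (intro finsum_cong') (auto simp: l_distr)
  also have "\<dots> = vecmat X v A y \<oplus> vecmat X w A y"
    unfolding vecmat_def using assms by (intro finsum_addf) auto
  finally show ?thesis .
qed

lemma vecmat_add_right:
  assumes "\<And>x. x \<in> X \<Longrightarrow> v x \<in> carrier R" "\<And>x. x \<in> X \<Longrightarrow> A x y \<in> carrier R"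
    "\<And>x. x \<in> X \<Longrightarrow> B x y \<in> carrier R"
  shows "vecmat X v (\<lambda>x y. A x y \<oplus> B x y) y = vecmat X v A y \<oplus> vecmat X v B y"
proof -
  have "vecmat X v (\<lambda>x y. A x y \<oplus> B x y) y = (\<Oplus>x\<in>X. v x \<otimes> A x y \<oplus> v x \<otimes> B x y)"
    unfolding vecmat_def using assms by (intro finsum_cong') (auto simp: r_distr)
  also have "\<dots> = vecmat X v A y \<oplus> vecmat X v B y"
    unfolding vecmat_def using assms by (intro finsum_addf) auto
  finally show ?thesis .
qed

lemma eq_minusI:
  assumes "a \<in> carrier R" "b \<in> carrier R" "a \<oplus> b = c"
  shows "a = c \<ominus> b"
proof -
  have "c \<ominus> b = a \<oplus> (b \<oplus> \<ominus> b)" using assms by (auto simp: minus_eq a_assoc)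
  then show ?thesis using assms by (simp add: r_neg)
qed

lemma minus_add_cancel': "a \<in> carrier R \<Longrightarrow> b \<in> carrier R \<Longrightarrow> (a \<ominus> b) \<oplus> b = a"
  by (simp add: minus_eq a_assoc l_neg)

lemma vecmat_minus_left:
  assumes "\<And>x. x \<in> X \<Longrightarrow> v x \<in> carrier R" "\<And>x. x \<in> X \<Longrightarrow> w x \<in> carrier R"
    "\<And>x. x \<in> X \<Longrightarrow> A x y \<in> carrier R"
  shows "vecmat X (\<lambda>x. v x \<ominus> w x) A y = vecmat X v A y \<ominus> vecmat X w A y"
proof (rule eq_minusI)
  have "vecmat X (\<lambda>x. v x \<ominus> w x) A y \<oplus> vecmat X w A y =
      vecmat X (\<lambda>x. v x \<ominus> w x \<oplus> w x) A y"
    using assms by (intro vecmat_add_left[symmetric]) auto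
  also have "\<dots> = vecmat X v A y"
    unfolding vecmat_def using assms by (intro finsum_cong') (auto simp: minus_add_cancel')
  finally show "vecmat X (\<lambda>x. v x \<ominus> w x) A y \<oplus> vecmat X w A y = vecmat X v A y" .
qed (use assms in \<open>auto intro!: vecmat_closed\<close>)

lemma vecmat_minus_right:
  assumes "\<And>x. x \<in> X \<Longrightarrow> v x \<in> carrier R" "\<And>x. x \<in> X \<Longrightarrow> A x y \<in> carrier R"
    "\<And>x. x \<in> X \<Longrightarrow> B x y \<in> carrier R"
  shows "vecmat X v (\<lambda>x y. A x y \<ominus> B x y) y = vecmat X v A y \<ominus> vecmat X v B y"
proof (rule eq_minusI)
  have "vecmat X v (\<lambda>x y. A x y \<ominus> B x y) y \<oplus> vecmat X v B y =
      vecmat X v (\<lambda>x y. A x y \<ominus> B x y \<oplus> B x y) y"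
    using assms by (intro vecmat_add_right[symmetric]) auto
  also have "\<dots> = vecmat X v A y"
    unfolding vecmat_def using assms by (intro finsum_cong') (auto simp: minus_add_cancel')
  finally show "vecmat X v (\<lambda>x y. A x y \<ominus> B x y) y \<oplus> vecmat X v B y = vecmat X v A y" .
qed (use assms in \<open>auto intro!: vecmat_closed\<close>)

lemma vecmat_zero_left:
  assumes "\<And>x y. x \<in> X \<Longrightarrow> A x y \<in> carrier R"
  shows "vecmat X (\<lambda>_. \<zero>) A = (\<lambda>_. \<zero>)"
proof
  fix y
  have "vecmat X (\<lambda>_. \<zero>) A y = (\<Oplus>x\<in>X. \<zero>)"
    unfolding vecmat_def using assms by (intro finsum_cong') auto
  then show "vecmat X (\<lambda>_. \<zero>) A y = \<zero>" by (simp add: finsum_zero)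
qed

lemma vecmat_zero_right:
  assumes "\<And>x. x \<in> X \<Longrightarrow> v x \<in> carrier R" "\<And>x y. x \<in> X \<Longrightarrow> A x y = \<zero>"
  shows "vecmat X v A = (\<lambda>_. \<zero>)"
proof
  fix y
  have "vecmat X v A y = (\<Oplus>x\<in>X. \<zero>)"
    unfolding vecmat_def using assms by (intro finsum_cong') auto
  then show "vecmat X v A y = \<zero>" by (simp add: finsum_zero)
qed

end

text \<open>
  The matrices of a chain complex of finitely generated projective modules: \<open>e i\<close> is the
  idempotent that cuts out the \<open>i\<close>-th module from a free module with basis \<open>X i\<close>, and
  \<open>D i\<close> is the differential. Vectors are rows and matrices act from the right.
\<close>

locale matrix_complex = ring +
  fixes X :: "int \<Rightarrow> 'm set" and e D :: "int \<Rightarrow> 'm \<Rightarrow> 'm \<Rightarrow> 'a"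
  assumes finX: "finite (X i)"
    and e_closed: "x \<in> X i \<Longrightarrow> e i x y \<in> carrier R"
    and D_closed: "x \<in> X i \<Longrightarrow> D i x y \<in> carrier R"
    and ee: "x \<in> X i \<Longrightarrow> vecmat (X i) (e i x) (e i) = e i x"
    and eD: "x \<in> X i \<Longrightarrow> vecmat (X i) (e i x) (D i) = D i x"
    and De: "x \<in> X i \<Longrightarrow> vecmat (X (i - 1)) (D i x) (e (i - 1)) = D i x"
    and DD: "x \<in> X i \<Longrightarrow> vecmat (X (i - 1)) (D i x) (D (i - 1)) = (\<lambda>_. \<zero>)"
begin

text \<open>Chains are the rows fixed by the idempotent \<open>e i\<close>, that is, the elements of
  the summand of the free module that it cuts out.\<close>

definition cycles :: "int \<Rightarrow> ('m \<Rightarrow> 'a) set"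
  where "cycles i = {v \<in> UNIV \<rightarrow> carrier R.
    vecmat (X i) v (e i) = v \<and> vecmat (X i) v (D i) = (\<lambda>_. \<zero>)}"

text \<open>The set \<open>T\<close> varies while the matrices stay fixed, so one notion covers all
  coefficient rings. The preimage may be any row, not only a chain: by \<open>eD\<close>,
  multiplying it by \<open>e (i + 1)\<close> does not change its boundary.\<close>

definition exact_at :: "'a set \<Rightarrow> int \<Rightarrow> bool"
  where "exact_at T i \<longleftrightarrow> (\<forall>v \<in> cycles i \<inter> (UNIV \<rightarrow> T).
    \<exists>w \<in> UNIV \<rightarrow> T. vecmat (X (i + 1)) w (D (i + 1)) = v)"

text \<open>A contracting homotopy on cycles only. The point is uniformity: one matrix yields
  preimages of all cycles at once.\<close>

definition splits :: "int \<Rightarrow> ('m \<Rightarrow> 'm \<Rightarrow> 'a) \<Rightarrow> bool"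
  where "splits i s \<longleftrightarrow> (\<forall>x y. s x y \<in> carrier R) \<and>
    (\<forall>v\<in>cycles i. vecmat (X (i + 1)) (vecmat (X i) v s) (D (i + 1)) = v)"

lemma cyclesD:
  assumes "v \<in> cycles i"
  shows "v x \<in> carrier R" "vecmat (X i) v (e i) = v" "vecmat (X i) v (D i) = (\<lambda>_. \<zero>)"
  using assms by (auto simp: cycles_def)

lemma splits_zero:
  assumes "\<And>x y. x \<in> X i \<Longrightarrow> e i x y = \<zero>"
  shows "splits i (\<lambda>_ _. \<zero>)"
proof -
  have "vecmat (X (i + 1)) (vecmat (X i) v (\<lambda>_ _. \<zero>)) (D (i + 1)) = v" if v: "v \<in> cycles i" for v
  proof -
    have "v = (\<lambda>_. \<zero>)"
      using cyclesD(2)[OF v] vecmat_zero_right[of "X i" v "e i"] cyclesD(1)[OF v] assms by simp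
    moreover have "vecmat (X i) v (\<lambda>_ _. \<zero>) = (\<lambda>_. \<zero>)"
      using cyclesD(1)[OF v] by (intro vecmat_zero_right) auto
    ultimately show ?thesis using D_closed by (simp add: vecmat_zero_left)
  qed
  then show ?thesis by (simp add: splits_def)
qed

text \<open>Boundaries are cycles by \<open>De\<close> and \<open>DD\<close>. This keeps the
  successive remainders of the approximation among the cycles.\<close>

lemma minus_boundary_cycle:
  assumes v: "v \<in> cycles i" and w: "\<And>x. w x \<in> carrier R"
  shows "(\<lambda>x. v x \<ominus> vecmat (X (i + 1)) w (D (i + 1)) x) \<in> cycles i"
proof -
  let ?b = "vecmat (X (i + 1)) w (D (i + 1))"
  have b: "?b x \<in> carrier R" for x using w D_closed by (intro vecmat_closed) auto
  have "vecmat (X i) ?b (e i) = vecmat (X (i + 1)) w (\<lambda>x. vecmat (X i) (D (i + 1) x) (e i))"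
    using w e_closed D_closed finX by (intro vecmat_assoc) auto
  also have "\<dots> = ?b" using De[of _ "i + 1"] w D_closed by (intro vecmat_cong) auto
  finally have be: "vecmat (X i) ?b (e i) = ?b" .
  have "vecmat (X i) ?b (D i) = vecmat (X (i + 1)) w (\<lambda>x. vecmat (X i) (D (i + 1) x) (D i))"
    using w D_closed finX by (intro vecmat_assoc) auto
  also have "\<dots> = (\<lambda>_. \<zero>)" using DD[of _ "i + 1"] w by (intro vecmat_zero_right) auto
  finally have bD: "vecmat (X i) ?b (D i) = (\<lambda>_. \<zero>)" .
  have "vecmat (X i) (\<lambda>x. v x \<ominus> ?b x) A = (\<lambda>y. vecmat (X i) v A y \<ominus> vecmat (X i) ?b A y)"
    if "\<And>x y. x \<in> X i \<Longrightarrow> A x y \<in> carrier R" for A :: "'m \<Rightarrow> 'm \<Rightarrow> 'a"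
    using cyclesD(1)[OF v] b that by (intro ext vecmat_minus_left) auto
  then show ?thesis
    using cyclesD[OF v] b be bD e_closed D_closed by (simp add: cycles_def minus_eq r_neg)
qed

text \<open>The matrix b = e - t with t = D s e projects onto the cycles. Its rows are cycles
  because t D = D: the rows of \<open>D i\<close> are cycles in degree i - 1, where \<open>s\<close>
  splits. And v b = v for a cycle \<open>v\<close>, since v D = 0. Exactness lifts the finitely many
  rows of \<open>b\<close>, and the lifts form the new splitting.\<close>

lemma splits_step:
  assumes s: "splits (i - 1) s" and ex: "exact_at (carrier R) i"
  shows "\<exists>s'. splits i s'"
proof -
  have sc: "s x y \<in> carrier R" for x y using s by (simp add: splits_def)
  \<comment> \<open>The final factor \<open>e i\<close> makes the rows chains, which the rows of
    \<open>s\<close> need not be.\<close>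
  define t where "t x = vecmat (X i) (vecmat (X (i - 1)) (D i x) s) (e i)" for x
  define b where "b x = (\<lambda>y. e i x y \<ominus> t x y)" for x
  have Dsc: "vecmat (X (i - 1)) (D i x) s y \<in> carrier R" if "x \<in> X i" for x y
    using that D_closed sc by (intro vecmat_closed) auto
  have tc: "t x y \<in> carrier R" if "x \<in> X i" for x y
    unfolding t_def using that Dsc e_closed by (simp add: vecmat_closed)
  have bc: "b x y \<in> carrier R" if "x \<in> X i" for x y
    using that tc e_closed by (auto simp: b_def)
  have b_cycle: "b x \<in> cycles i" if x: "x \<in> X i" for x
  proof -
    have Dx: "D i x \<in> cycles (i - 1)" using De[OF x] DD[OF x] D_closed[OF x] by (simp add: cycles_def)
    have "vecmat (X i) (t x) (e i) =
        vecmat (X i) (vecmat (X (i - 1)) (D i x) s) (\<lambda>y. vecmat (X i) (e i y) (e i))"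
      unfolding t_def using Dsc[OF x] e_closed finX by (intro vecmat_assoc) auto
    also have "\<dots> = t x"
      unfolding t_def using ee Dsc[OF x] e_closed by (intro vecmat_cong) auto
    finally have te: "vecmat (X i) (t x) (e i) = t x" .
    have "vecmat (X i) (t x) (D i) =
        vecmat (X i) (vecmat (X (i - 1)) (D i x) s) (\<lambda>y. vecmat (X i) (e i y) (D i))"
      unfolding t_def using Dsc[OF x] e_closed D_closed finX by (intro vecmat_assoc) auto
    also have "\<dots> = vecmat (X i) (vecmat (X (i - 1)) (D i x) s) (D i)"
      using eD Dsc[OF x] D_closed by (intro vecmat_cong) auto
    also have "\<dots> = D i x" using s Dx by (simp add: splits_def)
    finally have tD: "vecmat (X i) (t x) (D i) = D i x" .
    have "vecmat (X i) (b x) A = (\<lambda>y. vecmat (X i) (e i x) A y \<ominus> vecmat (X i) (t x) A y)"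
      if "\<And>x y. x \<in> X i \<Longrightarrow> A x y \<in> carrier R" for A :: "'m \<Rightarrow> 'm \<Rightarrow> 'a"
      unfolding b_def using x e_closed tc that by (intro ext vecmat_minus_left) auto
    then show ?thesis
      using x bc e_closed D_closed ee eD te tD by (simp add: cycles_def minus_eq r_neg) (simp add: b_def minus_eq)
  qed
  have "\<forall>x\<in>X i. \<exists>w. w \<in> UNIV \<rightarrow> carrier R \<and> vecmat (X (i + 1)) w (D (i + 1)) = b x"
    using ex b_cycle bc unfolding exact_at_def by blast
  then obtain w where w: "\<And>x. x \<in> X i \<Longrightarrow> w x \<in> UNIV \<rightarrow> carrier R"
    "\<And>x. x \<in> X i \<Longrightarrow> vecmat (X (i + 1)) (w x) (D (i + 1)) = b x"
    by metis
  \<comment> \<open>\<open>splits\<close> requires all entries to lie in the ring, while lifts were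
    obtained only for the rows indexed by \<open>X i\<close>.\<close>
  define s' where "s' x = (if x \<in> X i then w x else (\<lambda>_. \<zero>))" for x
  have s'c: "s' x y \<in> carrier R" for x y using w(1)[of x] by (auto simp: s'_def)
  have "vecmat (X (i + 1)) (vecmat (X i) v s') (D (i + 1)) = v" if v: "v \<in> cycles i" for v
  proof -
    have vc: "v x \<in> carrier R" for x using cyclesD(1)[OF v] .
    have "vecmat (X (i + 1)) (vecmat (X i) v s') (D (i + 1)) =
        vecmat (X i) v (\<lambda>x. vecmat (X (i + 1)) (s' x) (D (i + 1)))"
      using vc s'c D_closed finX by (intro vecmat_assoc) auto
    also have "\<dots> = vecmat (X i) v b"
      using vc bc w(2) by (intro vecmat_cong) (auto simp: s'_def)
    also have "\<dots> = (\<lambda>y. vecmat (X i) v (e i) y \<ominus> vecmat (X i) v t y)"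
      unfolding b_def using vc e_closed tc by (intro ext vecmat_minus_right) auto
    also have "vecmat (X i) v t = vecmat (X i) (vecmat (X i) v (\<lambda>x. vecmat (X (i - 1)) (D i x) s)) (e i)"
      unfolding t_def using vc Dsc e_closed finX by (intro vecmat_assoc[symmetric]) auto
    also have "vecmat (X i) v (\<lambda>x. vecmat (X (i - 1)) (D i x) s) =
        vecmat (X (i - 1)) (vecmat (X i) v (D i)) s"
      using vc D_closed sc finX by (intro vecmat_assoc[symmetric]) auto
    finally show ?thesis
      using cyclesD(2,3)[OF v] vc sc e_closed by (simp add: vecmat_zero_left minus_eq)
  qed
  then show ?thesis using s'c unfolding splits_def by blast
qed

lemma splits_exists:
  assumes "\<And>i x y. i < 0 \<Longrightarrow> x \<in> X i \<Longrightarrow> e i x y = \<zero>"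
    and "\<And>i. i \<le> n \<Longrightarrow> exact_at (carrier R) i" and "i \<le> n"
  shows "\<exists>s. splits i s"
proof (cases "i < 0")
  case True
  then show ?thesis using splits_zero assms(1) by blast
next
  case False
  \<comment> \<open>The shift by one starts the induction in degree -1, where \<open>e\<close>
    vanishes and the zero matrix splits.\<close>
  have "int k - 1 \<le> n \<longrightarrow> (\<exists>s. splits (int k - 1) s)" for k
  proof (induction k)
    case 0
    show ?case using splits_zero[of "-1"] assms(1)[of "-1"] by auto
  next
    case (Suc k)
    then show ?case using splits_step[of "int k"] assms(2)[of "int k"] by auto
  qed
  from this[of "nat (i + 1)"] show ?thesis using False assms(3) by simp
qed

end

section \<open>Solving boundary equations by successive approximation\<close>

context novikov
begin

lemma finite_filt_bound:
  assumes "finite B" "B \<subseteq> carrier (nov \<rat>)"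
  shows "\<exists>c\<ge>0. B \<subseteq> filt (- c)"
  using assms
proof (induction B)
  case (insert x B)
  then obtain c where c: "c \<ge> 0" "B \<subseteq> filt (- c)" by auto
  obtain a where "x \<in> filt a" using nov_bounded_below insert by blast
  then have "insert x B \<subseteq> filt (- max c (- a))"
    using c filt_mono[of "- max c (- a)" a, OF minus_le_iff[THEN iffD1]] filt_mono[of "- max c (- a)" "- c"] by auto
  then show ?case using c by (intro exI[of _ "max c (- a)"]) auto
qed auto

lemma filt_vecmat:
  assumes "\<And>x. x \<in> X \<Longrightarrow> v x \<in> filt a" "\<And>x. x \<in> X \<Longrightarrow> M x y \<in> filt b"
  shows "ring.vecmat (nov \<rat>) X v M y \<in> filt (a + b)"
  using assms by (auto simp: ring.vecmat_def[OF nov_ring] intro!: filt_finsum filt_mult)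

text \<open>
  Iterating \<open>z \<mapsto> z - z s' D = z (s - s') D\<close> raises the filtration degree by one in
  each step, so the preimages \<open>z s'\<close> of the successive differences have a convergent sum.
\<close>

lemma solve_by_approximation:
  fixes D :: "'i \<Rightarrow> 'i \<Rightarrow> 'g \<Rightarrow> rat"
  defines "vm \<equiv> ring.vecmat (nov \<rat>)"
  assumes A: "rat_subring A" "A \<subseteq> \<rat>" and fin: "finite X" "finite Y"
    and D: "\<And>y x. y \<in> Y \<Longrightarrow> D y x \<in> filt (- c)" "\<And>y x. y \<in> Y \<Longrightarrow> D y x \<in> carrier (nov A)" "c \<ge> 0"
    and s: "\<And>x y. s x y \<in> carrier (nov \<rat>)"
    and s': "\<And>x y. s' x y \<in> carrier (nov A)"
    and ss': "\<And>x y. x \<in> X \<Longrightarrow> y \<in> Y \<Longrightarrow> s x y \<ominus>\<^bsub>nov \<rat>\<^esub> s' x y \<in> filt (c + 1)"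
    and split: "\<And>v. v \<in> Z \<Longrightarrow> vm Y (vm X v s) D = v"
    and Z: "\<And>v. v \<in> Z \<Longrightarrow> (\<lambda>x. v x \<ominus>\<^bsub>nov \<rat>\<^esub> vm Y (vm X v s') D x) \<in> Z"
    and v: "v \<in> Z" "\<And>x. v x \<in> filt a" "\<And>x. v x \<in> carrier (nov A)"
  shows "\<exists>w \<in> UNIV \<rightarrow> carrier (nov A). vm Y w D = v"
proof -
  interpret N: ring "nov \<rat>" by (rule nov_ring)
  note sub = subring_nov[OF A]
  note AQ = subsetD[OF nov_mono[OF A(2)]]
  define z where "z = rec_nat v (\<lambda>_ u x. u x \<ominus>\<^bsub>nov \<rat>\<^esub> vm Y (vm X u s') D x)"
  have z0: "z 0 = v" and zS: "z (Suc k) = (\<lambda>x. z k x \<ominus>\<^bsub>nov \<rat>\<^esub> vm Y (vm X (z k) s') D x)" for k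
    by (simp_all add: z_def)
  have zZ: "z k \<in> Z" for k by (induction k) (use v Z in \<open>auto simp: z0 zS\<close>)
  have wA: "vm X u s' y \<in> carrier (nov A)" if "\<And>x. u x \<in> carrier (nov A)" for u y
    unfolding vm_def using that s' by (intro N.vecmat_closed_subring[OF sub]) auto
  have vmA: "vm Y u D x \<in> carrier (nov A)" if "\<And>y. u y \<in> carrier (nov A)" for u x
    unfolding vm_def using that D(2) by (intro N.vecmat_closed_subring[OF sub]) auto
  have zA: "z k x \<in> carrier (nov A)" for k x
  proof (induction k arbitrary: x)
    case (Suc k)
    then show ?case unfolding zS N.minus_eq
      using wA vmA subringE(5,7)[OF sub] by auto
  qed (simp add: z0 v)
  note zQ = AQ[OF zA] and s'Q = AQ[OF s'] and DQ = filtD(1)[OF D(1)]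
  have zS': "z (Suc k) x = vm Y (vm X (z k) (\<lambda>x y. s x y \<ominus>\<^bsub>nov \<rat>\<^esub> s' x y)) D x" for k x
  proof -
    have 1: "vm X (z k) s y \<in> carrier (nov \<rat>)" "vm X (z k) s' y \<in> carrier (nov \<rat>)" for y
      unfolding vm_def using zQ s s'Q by (auto intro!: N.vecmat_closed)
    have "vm Y (vm X (z k) (\<lambda>x y. s x y \<ominus>\<^bsub>nov \<rat>\<^esub> s' x y)) D x =
        vm Y (\<lambda>y. vm X (z k) s y \<ominus>\<^bsub>nov \<rat>\<^esub> vm X (z k) s' y) D x"
    proof -
      have "vm X (z k) (\<lambda>x y. s x y \<ominus>\<^bsub>nov \<rat>\<^esub> s' x y) =
          (\<lambda>y. vm X (z k) s y \<ominus>\<^bsub>nov \<rat>\<^esub> vm X (z k) s' y)"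
        unfolding vm_def using zQ s s'Q by (intro ext N.vecmat_minus_right) auto
      then show ?thesis by simp
    qed
    also have "\<dots> = vm Y (vm X (z k) s) D x \<ominus>\<^bsub>nov \<rat>\<^esub> vm Y (vm X (z k) s') D x"
      unfolding vm_def using 1[unfolded vm_def] DQ by (intro N.vecmat_minus_left) auto
    finally show ?thesis using split[OF zZ] by (simp add: zS)
  qed
  have zf: "z k x \<in> filt (a + real k)" for k x
  proof (induction k arbitrary: x)
    case (Suc k)
    \<comment> \<open>The factor s - s' gains c + 1 and \<open>D\<close> loses at most
      \<open>c\<close>: this is the origin of the truncation level.\<close>
    have "vm X (z k) (\<lambda>x y. s x y \<ominus>\<^bsub>nov \<rat>\<^esub> s' x y) y \<in> filt (a + real k + (c + 1))" if "y \<in> Y" for y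
      unfolding vm_def using Suc ss' that by - (rule filt_vecmat, auto)
    then have "z (Suc k) x \<in> filt (a + real k + (c + 1) + - c)"
      unfolding zS' vm_def using D(1) by - (rule filt_vecmat, auto)
    then show ?case by (simp add: algebra_simps)
  qed (simp add: z0 v)
  \<comment> \<open>Multiplication by s' may lower the level by \<open>c'\<close>. This shifts the
    start of the series of preimages but not its rate of convergence.\<close>
  obtain c' where c': "c' \<ge> 0" "\<And>x y. x \<in> X \<Longrightarrow> y \<in> Y \<Longrightarrow> s' x y \<in> filt (- c')"
    using finite_filt_bound[of "case_prod s' ` (X \<times> Y)"] fin s'Q by (auto simp: image_subset_iff)
  define w where "w k y = vm X (z k) s' y" for k y
  have w: "w k y \<in> carrier (nov A)" for k y using wA zA by (simp add: w_def)
  note wQ = AQ[OF w]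
  have wf: "w k y \<in> filt (a + - c' + real k)" if "y \<in> Y" for k y
  proof -
    have "w k y \<in> filt (a + real k + - c')"
      unfolding w_def vm_def using c' zf that by - (rule filt_vecmat, auto)
    then show ?thesis by (simp add: algebra_simps)
  qed
  define W where "W m y = finsum (nov \<rat>) (\<lambda>k. w k y) {..<m}" for m y
  have WQ: "W m y \<in> carrier (nov \<rat>)" for m y using wQ by (auto simp: W_def)
  have WS: "W (Suc m) y = W m y \<oplus>\<^bsub>nov \<rat>\<^esub> w m y" for m y
    using wQ WQ by (simp add: W_def lessThan_Suc N.a_comm)
  have W0: "W 0 y = \<zero>\<^bsub>nov \<rat>\<^esub>" for y by (simp add: W_def)
  \<comment> \<open>Convergence is known only for \<open>y\<close> in \<open>Y\<close>, where s' has
    the common bound. For other \<open>y\<close> any element of the ring will do, since products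
    with \<open>D\<close> sum over \<open>Y\<close> only.\<close>
  have "\<forall>y. \<exists>u. u \<in> carrier (nov A) \<and>
      (y \<in> Y \<longrightarrow> (\<forall>m. u \<ominus>\<^bsub>nov \<rat>\<^esub> W m y \<in> filt (a + - c' + real m)))"
    using filt_complete[OF A, of "\<lambda>k. w k _", OF w wf] w unfolding W_def by blast
  then obtain u where u: "\<And>y. u y \<in> carrier (nov A)"
    "\<And>y m. y \<in> Y \<Longrightarrow> u y \<ominus>\<^bsub>nov \<rat>\<^esub> W m y \<in> filt (a + - c' + real m)"
    by metis
  note uQ = AQ[OF u(1)]
  have vmQ: "vm Y q D x \<in> carrier (nov \<rat>)" if "\<And>y. q y \<in> carrier (nov \<rat>)" for q x
    unfolding vm_def using that DQ by (intro N.vecmat_closed) auto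
  \<comment> \<open>The telescoping invariant: the boundary of the m-th partial sum of preimages and
    the m-th remainder add up to \<open>v\<close>.\<close>
  have WD: "vm Y (W m) D x \<oplus>\<^bsub>nov \<rat>\<^esub> z m x = v x" for m x
  proof (induction m)
    case 0
    have "W 0 = (\<lambda>_. \<zero>\<^bsub>nov \<rat>\<^esub>)" using W0 by auto
    then show ?case using DQ zQ[of 0] by (simp add: vm_def N.vecmat_zero_left z0)
  next
    case (Suc m)
    have "vm Y (W (Suc m)) D x = vm Y (W m) D x \<oplus>\<^bsub>nov \<rat>\<^esub> vm Y (w m) D x"
      unfolding WS[abs_def] vm_def using WQ wQ DQ by (intro N.vecmat_add_left) auto
    moreover have "z (Suc m) x \<oplus>\<^bsub>nov \<rat>\<^esub> vm Y (w m) D x = z m x"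
      using zQ vmQ[of "w m"] wQ N.minus_add_cancel' by (simp add: zS w_def[abs_def])
    ultimately show ?case
      using Suc zQ[of "Suc m" x] vmQ[of "w m" x, OF wQ] vmQ[of "W m" x, OF WQ]
        N.a_comm[of "z (Suc m) x" "vm Y (w m) D x"] by (simp add: N.a_assoc)
  qed
  \<comment> \<open>By \<open>WD\<close> this difference equals (u - W m) D - z m for every
    \<open>m\<close>. Both terms lie at level a - c' - c + m, so the difference vanishes by
    separation.\<close>
  have "vm Y u D x \<ominus>\<^bsub>nov \<rat>\<^esub> v x = \<zero>\<^bsub>nov \<rat>\<^esub>" for x
  proof (rule filt_separated)
    fix m :: nat
    let ?d = "vm Y (\<lambda>y. u y \<ominus>\<^bsub>nov \<rat>\<^esub> W m y) D x"
    have "?d \<in> filt (a + - c' + real m + - c)"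
      unfolding vm_def using u(2) D(1) by - (rule filt_vecmat, auto)
    then have d: "?d \<in> filt (a - c' - c + real m)" by (simp add: algebra_simps)
    have "z m x \<in> filt (a - c' - c + real m)"
      using zf[of m x] filt_mono[of "a - c' - c + real m" "a + real m"] c' D(3) by auto
    then have "?d \<ominus>\<^bsub>nov \<rat>\<^esub> z m x \<in> filt (a - c' - c + real m)" using d by (rule filt_minus[rotated])
    moreover have "?d = vm Y u D x \<ominus>\<^bsub>nov \<rat>\<^esub> vm Y (W m) D x"
      unfolding vm_def using uQ WQ DQ by (intro N.vecmat_minus_left) auto
    ultimately show "vm Y u D x \<ominus>\<^bsub>nov \<rat>\<^esub> v x \<in> filt (a - c' - c + real m)"
      using WD[of m x, symmetric] vmQ[of u x] vmQ[of "W m" x] uQ WQ zQ[of m x]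
      by (auto simp: N.minus_eq N.minus_add N.a_assoc)
  qed
  then have "vm Y u D x = v x" for x
    using N.r_right_minus_eq[of "vm Y u D x" "v x"] vmQ[of u x] uQ zQ[of 0 x] by (simp add: z0)
  then show ?thesis using u(1) by blast
qed

end

subsection \<open>Homology and dual bases\<close>

text \<open>A class is a coset of the image, and it contains its representative because the image
  contains the unit; so a trivial class has its representative in the image. Conversely
  \<open>trivial_group\<close> also demands the group laws, which are clear once the quotient is
  that of the kernel by itself.\<close>

lemma trivial_homology_iff:
  assumes D: "\<And>i. comm_group (D i)" and \<delta>: "\<And>i. \<delta> i \<in> hom (D i) (D (i - 1))"
    and \<delta>\<delta>: "\<And>x. x \<in> carrier (D (i + 1)) \<Longrightarrow> \<delta> i (\<delta> (i + 1) x) = \<one>\<^bsub>D (i - 1)\<^esub>"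
  shows "trivial_group (homology D \<delta> i) \<longleftrightarrow>
    kernel (D i) (D (i - 1)) (\<delta> i) \<subseteq> \<delta> (i + 1) ` carrier (D (i + 1))"
proof -
  let ?K = "kernel (D i) (D (i - 1)) (\<delta> i)" and ?B = "\<delta> (i + 1) ` carrier (D (i + 1))"
  interpret Di: comm_group "D i" by (rule D)
  interpret D': comm_group "D (i - 1)" by (rule D)
  interpret D1: comm_group "D (i + 1)" by (rule D)
  interpret h: group_hom "D i" "D (i - 1)" "\<delta> i"
    by (intro group_hom.intro group_hom_axioms.intro \<delta>) unfold_locales
  interpret h1: group_hom "D (i + 1)" "D i" "\<delta> (i + 1)"
    using \<delta>[of "i + 1"] by (intro group_hom.intro group_hom_axioms.intro) (simp_all, unfold_locales)
  have BK: "?B \<subseteq> ?K" using \<delta>\<delta> by (auto simp: kernel_def)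
  have B: "\<one>\<^bsub>D i\<^esub> \<in> ?B" using subgroup.one_closed[OF h1.img_is_subgroup] by simp
  have carrier: "carrier (homology D \<delta> i) = (\<lambda>x. ?B #>\<^bsub>D i\<^esub> x) ` ?K"
    and one: "\<one>\<^bsub>homology D \<delta> i\<^esub> = ?B"
    by (simp_all add: homology_def carrier_FactGroup r_coset_def)
  show ?thesis
  proof
    assume triv: "trivial_group (homology D \<delta> i)"
    have eq: "?B #>\<^bsub>D i\<^esub> x = ?B" if "x \<in> ?K" for x
    proof -
      have "?B #>\<^bsub>D i\<^esub> x \<in> carrier (homology D \<delta> i)"
        unfolding carrier using that by (rule imageI)
      then show ?thesis using triv unfolding trivial_group_def one by (metis singletonD)
    qed
    show "?K \<subseteq> ?B"
    proof
      fix x assume x: "x \<in> ?K"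
      then have "\<one>\<^bsub>D i\<^esub> \<otimes>\<^bsub>D i\<^esub> x \<in> ?B #>\<^bsub>D i\<^esub> x" using B by (auto simp: r_coset_def)
      then show "x \<in> ?B" using x eq[OF x] by (simp add: kernel_def)
    qed
  next
    assume "?K \<subseteq> ?B"
    then have KB: "?B = ?K" using BK by auto
    let ?H = "(D i)\<lparr>carrier := ?K\<rparr>"
    interpret H: group ?H by (rule Di.subgroup_imp_group[OF h.subgroup_kernel])
    have "?K \<lhd> ?H" using H.normal_self by simp
    then have "group (?H Mod ?K)" by (rule normal.factorgroup_is_group)
    moreover have "carrier (?H Mod ?K) = {?K}"
    proof -
      have "?K #>\<^bsub>?H\<^esub> x = ?K" if "x \<in> ?K" for x
        using H.coset_join2[of x ?K] H.subgroup_self that by simp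
      moreover have "?K \<noteq> {}" using B KB by auto
      ultimately show ?thesis by (auto simp: carrier_FactGroup)
    qed
    ultimately show "trivial_group (homology D \<delta> i)"
      by (simp add: homology_def KB trivial_group_def)
  qed
qed

text \<open>The data of the dual basis lemma. The functionals are indexed by the whole type and
  vanish off \<open>X\<close>, so that coordinates form a row supported in \<open>X\<close> and the
  idempotent matrices have zero columns outside \<open>X\<close>.\<close>

definition dual_basis ::
  "('r, 'k) ring_scheme \<Rightarrow> ('r, 'm) module \<Rightarrow> 'm set \<Rightarrow> ('m \<Rightarrow> 'm \<Rightarrow> 'r) \<Rightarrow> bool"
  where "dual_basis R M X f \<longleftrightarrow> finite X \<and> X \<subseteq> carrier M \<and>
    (\<forall>x. \<forall>m\<in>carrier M. f x m \<in> carrier R) \<and>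
    (\<forall>x. x \<notin> X \<longrightarrow> (\<forall>m\<in>carrier M. f x m = \<zero>\<^bsub>R\<^esub>)) \<and>
    (\<forall>x. \<forall>m\<in>carrier M. \<forall>n\<in>carrier M. f x (m \<oplus>\<^bsub>M\<^esub> n) = f x m \<oplus>\<^bsub>R\<^esub> f x n) \<and>
    (\<forall>x. \<forall>r\<in>carrier R. \<forall>m\<in>carrier M. f x (r \<odot>\<^bsub>M\<^esub> m) = r \<otimes>\<^bsub>R\<^esub> f x m) \<and>
    (\<forall>m\<in>carrier M. (\<Oplus>\<^bsub>M\<^esub>x\<in>X. f x m \<odot>\<^bsub>M\<^esub> x) = m)"

lemma dual_basisD:
  assumes "dual_basis R M X f"
  shows "finite X" "X \<subseteq> carrier M" "x \<in> X \<Longrightarrow> x \<in> carrier M"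
    "m \<in> carrier M \<Longrightarrow> f x m \<in> carrier R"
    "x \<notin> X \<Longrightarrow> m \<in> carrier M \<Longrightarrow> f x m = \<zero>\<^bsub>R\<^esub>"
    "m \<in> carrier M \<Longrightarrow> n \<in> carrier M \<Longrightarrow> f x (m \<oplus>\<^bsub>M\<^esub> n) = f x m \<oplus>\<^bsub>R\<^esub> f x n"
    "r \<in> carrier R \<Longrightarrow> m \<in> carrier M \<Longrightarrow> f x (r \<odot>\<^bsub>M\<^esub> m) = r \<otimes>\<^bsub>R\<^esub> f x m"
    "m \<in> carrier M \<Longrightarrow> (\<Oplus>\<^bsub>M\<^esub>x\<in>X. f x m \<odot>\<^bsub>M\<^esub> x) = m"
  using assms unfolding dual_basis_def by blast+

section \<open>Dual bases of finitely generated projective modules\<close>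

context left_module
begin

lemma smult_zero: "a \<in> carrier R \<Longrightarrow> a \<odot>\<^bsub>M\<^esub> \<zero>\<^bsub>M\<^esub> = \<zero>\<^bsub>M\<^esub>"
  using smult_r_distr[of a "\<zero>\<^bsub>M\<^esub>" "\<zero>\<^bsub>M\<^esub>"] smult_closed[of a "\<zero>\<^bsub>M\<^esub>"] M.add.r_cancel_one' by simp

lemma smult_finsum:
  assumes "a \<in> carrier R" "f \<in> X \<rightarrow> carrier M"
  shows "a \<odot>\<^bsub>M\<^esub> (\<Oplus>\<^bsub>M\<^esub>x\<in>X. f x) = (\<Oplus>\<^bsub>M\<^esub>x\<in>X. a \<odot>\<^bsub>M\<^esub> f x)"
  using assms(2)
proof (induction X rule: infinite_finite_induct)
  case (insert x X)
  then have "f \<in> X \<rightarrow> carrier M" "f x \<in> carrier M" by auto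
  moreover from this have "(\<lambda>x. a \<odot>\<^bsub>M\<^esub> f x) \<in> X \<rightarrow> carrier M" "a \<odot>\<^bsub>M\<^esub> f x \<in> carrier M"
    using assms(1) smult_closed by auto
  ultimately show ?case
    using insert assms(1) by (simp add: smult_r_distr)
qed (simp_all add: smult_zero assms(1))

lemma additive_finsum:
  assumes N: "abelian_group N" and h: "h \<in> carrier M \<rightarrow> carrier N"
    and add: "\<And>x y. x \<in> carrier M \<Longrightarrow> y \<in> carrier M \<Longrightarrow> h (x \<oplus>\<^bsub>M\<^esub> y) = h x \<oplus>\<^bsub>N\<^esub> h y"
    and f: "f \<in> X \<rightarrow> carrier M"
  shows "h (\<Oplus>\<^bsub>M\<^esub>x\<in>X. f x) = (\<Oplus>\<^bsub>N\<^esub>x\<in>X. h (f x))"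
proof -
  interpret N: abelian_group N by (rule N)
  have "h \<zero>\<^bsub>M\<^esub> \<oplus>\<^bsub>N\<^esub> h \<zero>\<^bsub>M\<^esub> = h \<zero>\<^bsub>M\<^esub>" using add[of "\<zero>\<^bsub>M\<^esub>" "\<zero>\<^bsub>M\<^esub>"] by simp
  moreover have "h \<zero>\<^bsub>M\<^esub> \<in> carrier N" using h by auto
  ultimately have zero: "h \<zero>\<^bsub>M\<^esub> = \<zero>\<^bsub>N\<^esub>" using N.add.r_cancel_one by metis
  show ?thesis using f
  proof (induction X rule: infinite_finite_induct)
    case (insert x X)
    then have "f \<in> X \<rightarrow> carrier M" "f x \<in> carrier M" by auto
    moreover from this have "(\<lambda>x. h (f x)) \<in> X \<rightarrow> carrier N" "h (f x) \<in> carrier N"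
      using h by auto
    ultimately show ?case using insert by (simp add: add)
  qed (simp_all add: zero)
qed

text \<open>Lifting the identity of \<open>M\<close> through the surjection from the free module on
  the generators gives a section; its components are the functionals.\<close>

lemma dual_basis_exists:
  assumes fg: "fin_gen_module R M" and proj: "projective_module R M"
  shows "\<exists>X f. dual_basis R M X f"
proof -
  obtain X where X: "X \<subseteq> carrier M" "finite X"
    and gen: "\<And>m. m \<in> carrier M \<Longrightarrow> \<exists>c\<in>X \<rightarrow> carrier R. m = (\<Oplus>\<^bsub>M\<^esub>s\<in>X. c s \<odot>\<^bsub>M\<^esub> s)"
    using fg unfolding fin_gen_module_def by blast
  \<comment> \<open>Taking the generators themselves as indices gives the free module the very type
    that \<open>projective_module\<close> prescribes for the source of the surjection.\<close>
  define F :: "('r, 'm \<Rightarrow> 'r) module" where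
    "F = \<lparr>carrier = X \<rightarrow>\<^sub>E carrier R, monoid.mult = undefined, one = undefined,
      ring.zero = (\<lambda>x\<in>X. \<zero>), add = (\<lambda>c c'. \<lambda>x\<in>X. c x \<oplus> c' x),
      smult = (\<lambda>a c. \<lambda>x\<in>X. a \<otimes> c x)\<rparr>"
  have sel: "carrier F = X \<rightarrow>\<^sub>E carrier R" "\<zero>\<^bsub>F\<^esub> = (\<lambda>x\<in>X. \<zero>)"
    "add F = (\<lambda>c c'. \<lambda>x\<in>X. c x \<oplus> c' x)" "smult F = (\<lambda>a c. \<lambda>x\<in>X. a \<otimes> c x)"
    by (simp_all add: F_def)
  have ext: "c = c'" if "c \<in> carrier F" "c' \<in> carrier F" "\<And>x. x \<in> X \<Longrightarrow> c x = c' x" for c c'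
    using that unfolding sel by (meson PiE_ext)
  have val: "c x \<in> carrier R" if "c \<in> carrier F" "x \<in> X" for c x
    using that by (auto simp: sel)
  have "abelian_group F"
  proof (rule abelian_groupI)
    fix c assume c: "c \<in> carrier F"
    show "\<exists>c'\<in>carrier F. c' \<oplus>\<^bsub>F\<^esub> c = \<zero>\<^bsub>F\<^esub>"
      using val[OF c] by (intro bexI[of _ "\<lambda>x\<in>X. \<ominus> c x"]) (auto simp: sel R.l_neg)
    show "\<zero>\<^bsub>F\<^esub> \<oplus>\<^bsub>F\<^esub> c = c" by (rule ext) (use val[OF c] c in \<open>auto simp: sel\<close>)
  qed (auto simp: sel R.a_ac PiE_iff intro!: restrict_ext)
  then have F: "left_module R F"
  proof (intro left_module.intro left_module_axioms.intro)
    fix c assume c: "c \<in> carrier F"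
    show "\<one> \<odot>\<^bsub>F\<^esub> c = c" by (rule ext) (use val[OF c] c in \<open>auto simp: sel\<close>)
  qed (auto simp: sel R.l_distr R.r_distr R.m_assoc PiE_iff R.ring_axioms intro!: restrict_ext)
  define p where "p c = (\<Oplus>\<^bsub>M\<^esub>x\<in>X. c x \<odot>\<^bsub>M\<^esub> x)" for c
  have tm: "c x \<odot>\<^bsub>M\<^esub> x \<in> carrier M" if "c \<in> X \<rightarrow> carrier R" "x \<in> X" for c x
    using that X by (auto intro!: smult_closed)
  have cX: "c \<in> X \<rightarrow> carrier R" if "c \<in> carrier F" for c using that by (auto simp: sel)
  have p_hom: "p \<in> left_module_hom R F M"
    unfolding left_module_hom_def
  proof (safe)
    fix c assume c: "c \<in> carrier F"
    show "p c \<in> carrier M" unfolding p_def using tm[OF cX[OF c]] by (intro M.finsum_closed) auto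
    fix a assume a: "a \<in> carrier R"
    have "p (a \<odot>\<^bsub>F\<^esub> c) = (\<Oplus>\<^bsub>M\<^esub>x\<in>X. a \<odot>\<^bsub>M\<^esub> (c x \<odot>\<^bsub>M\<^esub> x))"
      unfolding p_def using a tm[OF cX[OF c]] val[OF c] X
      by (intro M.finsum_cong') (auto simp: sel smult_assoc1 subset_eq intro!: smult_closed)
    also have "\<dots> = a \<odot>\<^bsub>M\<^esub> p c"
      unfolding p_def using a tm[OF cX[OF c]] by (intro smult_finsum[symmetric]) auto
    finally show "p (a \<odot>\<^bsub>F\<^esub> c) = a \<odot>\<^bsub>M\<^esub> p c" .
  next
    fix c c' assume c: "c \<in> carrier F" and c': "c' \<in> carrier F"
    have "p (c \<oplus>\<^bsub>F\<^esub> c') = (\<Oplus>\<^bsub>M\<^esub>x\<in>X. c x \<odot>\<^bsub>M\<^esub> x \<oplus>\<^bsub>M\<^esub> c' x \<odot>\<^bsub>M\<^esub> x)"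
      unfolding p_def using tm[OF cX[OF c]] tm[OF cX[OF c']] val[OF c] val[OF c'] X
      by (intro M.finsum_cong') (auto simp: sel smult_l_distr subset_eq)
    also have "\<dots> = p c \<oplus>\<^bsub>M\<^esub> p c'"
      unfolding p_def using tm[OF cX[OF c]] tm[OF cX[OF c']]
      by (intro M.finsum_addf) auto
    finally show "p (c \<oplus>\<^bsub>F\<^esub> c') = p c \<oplus>\<^bsub>M\<^esub> p c'" .
  qed
  have p_surj: "p ` carrier F = carrier M"
  proof
    show "p ` carrier F \<subseteq> carrier M" using p_hom by (auto simp: left_module_hom_def)
    show "carrier M \<subseteq> p ` carrier F"
    proof
      fix m assume "m \<in> carrier M"
      then obtain c where c: "c \<in> X \<rightarrow> carrier R" "m = (\<Oplus>\<^bsub>M\<^esub>s\<in>X. c s \<odot>\<^bsub>M\<^esub> s)" using gen by blast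
      have "p (restrict c X) = m"
        unfolding p_def c(2) using tm[OF c(1)] by (intro M.finsum_cong') auto
      moreover have "restrict c X \<in> carrier F" using c by (auto simp: sel)
      ultimately show "m \<in> p ` carrier F" by blast
    qed
  qed
  have "(\<lambda>m. m) \<in> left_module_hom R M M" by (auto simp: left_module_hom_def)
  from proj[unfolded projective_module_def, rule_format, OF F left_module_axioms p_hom p_surj this]
  obtain g where g: "g \<in> left_module_hom R M F" "\<And>m. m \<in> carrier M \<Longrightarrow> p (g m) = m"
    by auto
  have gF: "g m \<in> carrier F" if "m \<in> carrier M" for m
    using g(1) that by (auto simp: left_module_hom_def)
  define f where "f x m = (if x \<in> X then g m x else \<zero>)" for x m
  have "(\<Oplus>\<^bsub>M\<^esub>x\<in>X. f x m \<odot>\<^bsub>M\<^esub> x) = m" if m: "m \<in> carrier M" for m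
    using g(2)[OF m] tm[OF cX[OF gF[OF m]]] unfolding p_def
    by (subst M.finsum_cong'[of X X "\<lambda>x. g m x \<odot>\<^bsub>M\<^esub> x"]) (auto simp: f_def)
  then have "dual_basis R M X f"
    using X g(1) val[OF gF] unfolding dual_basis_def
    by (auto simp: f_def left_module_hom_def sel)
  then show ?thesis by blast
qed

end

subsection \<open>Tensor products in coordinates\<close>

text \<open>\<open>R\<close> is the ring of the complex, \<open>T\<close> the ring to tensor with,
  and \<open>S\<close> an ambient ring for all calculations. \<open>T\<close> enters as a subset of
  \<open>S\<close> with restricted operations, so coordinates over different \<open>T\<close> are
  rows over the same \<open>S\<close>.\<close>

locale base_change = R: ring R + S: ring S
  for R :: "('r, 'k) ring_scheme" and S :: "('r, 'l) ring_scheme" +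
  fixes T :: "('r, 'n) ring_scheme"
  assumes subring_T: "subring (carrier T) S"
    and R_sub_T: "carrier R \<subseteq> carrier T"
    and zero_R: "\<zero>\<^bsub>R\<^esub> = \<zero>\<^bsub>S\<^esub>"
    and add_R: "a \<in> carrier R \<Longrightarrow> b \<in> carrier R \<Longrightarrow> a \<oplus>\<^bsub>R\<^esub> b = a \<oplus>\<^bsub>S\<^esub> b"
    and mult_R: "a \<in> carrier R \<Longrightarrow> b \<in> carrier R \<Longrightarrow> a \<otimes>\<^bsub>R\<^esub> b = a \<otimes>\<^bsub>S\<^esub> b"
    and add_T: "a \<in> carrier T \<Longrightarrow> b \<in> carrier T \<Longrightarrow> a \<oplus>\<^bsub>T\<^esub> b = a \<oplus>\<^bsub>S\<^esub> b"
    and mult_T: "a \<in> carrier T \<Longrightarrow> b \<in> carrier T \<Longrightarrow> a \<otimes>\<^bsub>T\<^esub> b = a \<otimes>\<^bsub>S\<^esub> b"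
begin

lemma T_S: "a \<in> carrier T \<Longrightarrow> a \<in> carrier S"
  using subringE(1)[OF subring_T] by blast

lemma R_T: "a \<in> carrier R \<Longrightarrow> a \<in> carrier T"
  using R_sub_T by blast

lemma R_S: "a \<in> carrier R \<Longrightarrow> a \<in> carrier S"
  using R_T T_S by blast

lemma T_closed:
  "\<zero>\<^bsub>S\<^esub> \<in> carrier T" "a \<in> carrier T \<Longrightarrow> b \<in> carrier T \<Longrightarrow> a \<oplus>\<^bsub>S\<^esub> b \<in> carrier T"
  "a \<in> carrier T \<Longrightarrow> b \<in> carrier T \<Longrightarrow> a \<otimes>\<^bsub>S\<^esub> b \<in> carrier T"
  "a \<in> carrier T \<Longrightarrow> b \<in> carrier T \<Longrightarrow> a \<ominus>\<^bsub>S\<^esub> b \<in> carrier T"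
  using subringE[OF subring_T] by (auto simp: S.minus_eq)

lemma finsum_R:
  assumes "f \<in> X \<rightarrow> carrier R"
  shows "finsum R f X = finsum S f X"
  using assms
proof (induction X rule: infinite_finite_induct)
  case (insert x X)
  then have "f \<in> X \<rightarrow> carrier R" "f x \<in> carrier R" by auto
  moreover from this have "f \<in> X \<rightarrow> carrier S" "f x \<in> carrier S" using R_S by auto
  moreover have "finsum R f X \<in> carrier R" using \<open>f \<in> X \<rightarrow> carrier R\<close> by simp
  ultimately show ?case using insert by (simp add: add_R)
qed (simp_all add: zero_R)

end

locale tensor_coords = base_change R S T + left_module R M
  for R :: "('r, 'k) ring_scheme" and S :: "('r, 'l) ring_scheme" and T :: "('r, 'n) ring_scheme"
    and M :: "('r, 'm) module" +
  fixes X :: "'m set" and f :: "'m \<Rightarrow> 'm \<Rightarrow> 'r"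
  assumes basis: "dual_basis R M X f"
begin

abbreviation "F \<equiv> tensor_free_group T M"
abbreviation "U \<equiv> tensor_subgroup R T M"

lemmas basisD = dual_basisD[OF basis]

lemma carrier_F: "a \<in> carrier F \<longleftrightarrow> Poly_Mapping.keys a \<subseteq> carrier T \<times> carrier M"
  by (simp add: tensor_free_group_def)

lemma F_sel: "\<one>\<^bsub>F\<^esub> = 0" "a \<otimes>\<^bsub>F\<^esub> b = a + b" "comm_group F" "group F"
  by (simp_all add: tensor_free_group_def abelian_free_Abelian_group)

lemma F_closed:
  "0 \<in> carrier F" "a \<in> carrier F \<Longrightarrow> b \<in> carrier F \<Longrightarrow> a + b \<in> carrier F"
  "a \<in> carrier F \<Longrightarrow> b \<in> carrier F \<Longrightarrow> a - b \<in> carrier F"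
  "s \<in> carrier T \<Longrightarrow> m \<in> carrier M \<Longrightarrow> frag_of (s, m) \<in> carrier F"
  using keys_add[of a b] keys_diff[of a b] by (auto simp: carrier_F)

lemma F_sum_closed: "(\<And>x. x \<in> Y \<Longrightarrow> g x \<in> carrier F) \<Longrightarrow> sum g Y \<in> carrier F"
  by (induction Y rule: infinite_finite_induct) (auto intro: F_closed)

lemma F_induct [consumes 1, case_names zero frag diff]:
  assumes "a \<in> carrier F" "P 0"
    and "\<And>s m. s \<in> carrier T \<Longrightarrow> m \<in> carrier M \<Longrightarrow> P (frag_of (s, m))"
    and "\<And>a b. a \<in> carrier F \<Longrightarrow> b \<in> carrier F \<Longrightarrow> P a \<Longrightarrow> P b \<Longrightarrow> P (a - b)"
  shows "P a"
proof -
  have "Poly_Mapping.keys a \<subseteq> carrier T \<times> carrier M" using assms(1) by (simp add: carrier_F)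
  then have "a \<in> carrier F \<and> P a"
    by (induction rule: frag_induction) (use assms in \<open>auto intro: F_closed\<close>)
  then show ?thesis ..
qed

lemma relations_in_F: "tensor_relations R T M \<subseteq> carrier F"
  unfolding tensor_relations_def
  by (auto intro!: F_closed smult_closed simp: add_T mult_T T_closed R_T)

lemma subgroup_U: "subgroup U F"
  unfolding tensor_subgroup_def
  by (rule group.generate_is_subgroup[OF F_sel(4) relations_in_F])

lemma U_F: "a \<in> U \<Longrightarrow> a \<in> carrier F"
  using subgroup.subset[OF subgroup_U] by blast

lemma U_closed: "0 \<in> U" "a \<in> U \<Longrightarrow> b \<in> U \<Longrightarrow> a + b \<in> U" "a \<in> U \<Longrightarrow> - a \<in> U"
  "a \<in> U \<Longrightarrow> b \<in> U \<Longrightarrow> a - b \<in> U"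
proof -
  show "0 \<in> U" using subgroup.one_closed[OF subgroup_U] by (simp add: F_sel)
  show add: "a \<in> U \<Longrightarrow> b \<in> U \<Longrightarrow> a + b \<in> U" for a b
    using subgroup.m_closed[OF subgroup_U] by (simp add: F_sel)
  show uminus: "a \<in> U \<Longrightarrow> - a \<in> U" for a
    using subgroup.m_inv_closed[OF subgroup_U, of a] U_F[of a]
    by (simp add: tensor_free_group_def)
  show "a \<in> U \<Longrightarrow> b \<in> U \<Longrightarrow> a - b \<in> U" using add[of a "- b"] uminus by simp
qed

lemma U_sum: "(\<And>x. x \<in> Y \<Longrightarrow> g x \<in> U) \<Longrightarrow> sum g Y \<in> U"
  by (induction Y rule: infinite_finite_induct) (auto intro: U_closed)

lemma relations_in_U: "tensor_relations R T M \<subseteq> U"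
  unfolding tensor_subgroup_def by (auto intro: generate.incl)

lemma U_add_left:
  assumes "s \<in> carrier T" "t \<in> carrier T" "m \<in> carrier M"
  shows "frag_of (s \<oplus>\<^bsub>S\<^esub> t, m) - frag_of (s, m) - frag_of (t, m) \<in> U"
proof -
  have "frag_of (s \<oplus>\<^bsub>T\<^esub> t, m) - frag_of (s, m) - frag_of (t, m) \<in> tensor_relations R T M"
    unfolding tensor_relations_def using assms by blast
  then show ?thesis using relations_in_U assms by (auto simp: add_T)
qed

lemma U_add_right:
  assumes "s \<in> carrier T" "m \<in> carrier M" "n \<in> carrier M"
  shows "frag_of (s, m \<oplus>\<^bsub>M\<^esub> n) - frag_of (s, m) - frag_of (s, n) \<in> U"
proof (rule subsetD[OF relations_in_U])
  show "frag_of (s, m \<oplus>\<^bsub>M\<^esub> n) - frag_of (s, m) - frag_of (s, n) \<in> tensor_relations R T M"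
    unfolding tensor_relations_def using assms by blast
qed

lemma U_smult:
  assumes "s \<in> carrier T" "r \<in> carrier R" "m \<in> carrier M"
  shows "frag_of (s \<otimes>\<^bsub>S\<^esub> r, m) - frag_of (s, r \<odot>\<^bsub>M\<^esub> m) \<in> U"
proof -
  have "frag_of (s \<otimes>\<^bsub>T\<^esub> r, m) - frag_of (s, r \<odot>\<^bsub>M\<^esub> m) \<in> tensor_relations R T M"
    unfolding tensor_relations_def using assms by blast
  then show ?thesis using relations_in_U assms by (auto simp: mult_T R_T)
qed

lemma U_zero_left: "m \<in> carrier M \<Longrightarrow> frag_of (\<zero>\<^bsub>S\<^esub>, m) \<in> U"
  using U_closed(3)[OF U_add_left[of "\<zero>\<^bsub>S\<^esub>" "\<zero>\<^bsub>S\<^esub>" m]] T_closed(1) by simp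

lemma U_zero_right: "s \<in> carrier T \<Longrightarrow> frag_of (s, \<zero>\<^bsub>M\<^esub>) \<in> U"
  using U_closed(3)[OF U_add_right[of s "\<zero>\<^bsub>M\<^esub>" "\<zero>\<^bsub>M\<^esub>"]] by simp

lemma U_minus_left:
  assumes "s \<in> carrier T" "t \<in> carrier T" "m \<in> carrier M"
  shows "frag_of (s, m) - frag_of (t, m) - frag_of (s \<ominus>\<^bsub>S\<^esub> t, m) \<in> U"
proof -
  have "(s \<ominus>\<^bsub>S\<^esub> t) \<oplus>\<^bsub>S\<^esub> t = s" using assms T_S by (simp add: S.minus_add_cancel')
  then show ?thesis
    using U_add_left[of "s \<ominus>\<^bsub>S\<^esub> t" t m] assms T_closed(4) by (simp add: algebra_simps)
qed

lemma U_finsum_right: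
  assumes "s \<in> carrier T" "finite Y" "g \<in> Y \<rightarrow> carrier M"
  shows "frag_of (s, \<Oplus>\<^bsub>M\<^esub>y\<in>Y. g y) - (\<Sum>y\<in>Y. frag_of (s, g y)) \<in> U"
  using assms(2,3)
proof (induction Y)
  case empty
  then show ?case using U_zero_right[OF assms(1)] by simp
next
  case (insert y Y)
  then have g: "g \<in> Y \<rightarrow> carrier M" "g y \<in> carrier M" by auto
  let ?m = "\<Oplus>\<^bsub>M\<^esub>y\<in>Y. g y"
  have "(frag_of (s, g y \<oplus>\<^bsub>M\<^esub> ?m) - frag_of (s, g y) - frag_of (s, ?m)) +
      (frag_of (s, ?m) - (\<Sum>y\<in>Y. frag_of (s, g y))) \<in> U"
    using insert g assms(1) by (intro U_closed(2) U_add_right) auto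
  then show ?case using insert g by (simp add: algebra_simps)
qed

text \<open>Coordinates are defined on the free abelian group, before dividing by the relations.
  \<open>SOME\<close> picks a homomorphism given by the universal property; \<open>coord_hom\<close>
  and \<open>coord_frag\<close> are the interface to it.\<close>

definition coord :: "('r \<times> 'm \<Rightarrow>\<^sub>0 int) \<Rightarrow> 'm \<Rightarrow> 'r"
  where "coord a x = (SOME h. h \<in> hom F (add_monoid S) \<and>
    (\<forall>s\<in>carrier T. \<forall>m\<in>carrier M. h (frag_of (s, m)) = s \<otimes>\<^bsub>S\<^esub> f x m)) a"

lemma coord_hom: "(\<lambda>a. coord a x) \<in> hom F (add_monoid S)"
  and coord_frag: "s \<in> carrier T \<Longrightarrow> m \<in> carrier M \<Longrightarrow> coord (frag_of (s, m)) x = s \<otimes>\<^bsub>S\<^esub> f x m"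
proof -
  have "(\<lambda>(s, m). s \<otimes>\<^bsub>S\<^esub> f x m) ` (carrier T \<times> carrier M) \<subseteq> carrier (add_monoid S)"
    using basisD(4) R_S T_S by auto
  from comm_group.free_Abelian_group_universal[OF S.a_comm_group this]
  obtain h where "h \<in> hom F (add_monoid S)"
    "\<And>p. p \<in> carrier T \<times> carrier M \<Longrightarrow> h (frag_of p) = (\<lambda>(s, m). s \<otimes>\<^bsub>S\<^esub> f x m) p"
    unfolding tensor_free_group_def by blast
  then have "\<exists>h. h \<in> hom F (add_monoid S) \<and>
      (\<forall>s\<in>carrier T. \<forall>m\<in>carrier M. h (frag_of (s, m)) = s \<otimes>\<^bsub>S\<^esub> f x m)"
    by (intro exI[of _ h]) auto
  from someI_ex[OF this]
  show "(\<lambda>a. coord a x) \<in> hom F (add_monoid S)"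
    "s \<in> carrier T \<Longrightarrow> m \<in> carrier M \<Longrightarrow> coord (frag_of (s, m)) x = s \<otimes>\<^bsub>S\<^esub> f x m"
    unfolding coord_def by auto
qed

lemma coord_S: "a \<in> carrier F \<Longrightarrow> coord a x \<in> carrier S"
  using coord_hom[of x] by (auto simp: hom_def)

lemma coord_add:
  "a \<in> carrier F \<Longrightarrow> b \<in> carrier F \<Longrightarrow> coord (a + b) x = coord a x \<oplus>\<^bsub>S\<^esub> coord b x"
  using coord_hom[of x] by (simp add: hom_def F_sel)

lemma coord_minus:
  assumes "a \<in> carrier F" "b \<in> carrier F"
  shows "coord (a - b) x = coord a x \<ominus>\<^bsub>S\<^esub> coord b x"
  using coord_add[of "a - b" b x] assms F_closed(3)[OF assms] coord_S
  by (intro S.eq_minusI) auto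

lemma coord_0: "coord 0 x = \<zero>\<^bsub>S\<^esub>"
  using coord_minus[of 0 0 x] coord_S[of 0 x] F_closed(1) by (simp add: S.minus_eq S.r_neg)

lemma coord_sum:
  assumes "\<And>y. y \<in> Y \<Longrightarrow> g y \<in> carrier F"
  shows "coord (sum g Y) x = (\<Oplus>\<^bsub>S\<^esub>y\<in>Y. coord (g y) x)"
  using assms
proof (induction Y rule: infinite_finite_induct)
  case (insert y Y)
  then have "(\<lambda>y. coord (g y) x) \<in> Y \<rightarrow> carrier S" "coord (g y) x \<in> carrier S"
    using coord_S by auto
  then show ?case using insert F_sum_closed[of Y g] by (simp add: coord_add)
qed (simp_all add: coord_0)

lemma coord_T: "a \<in> carrier F \<Longrightarrow> coord a x \<in> carrier T"
  by (induction rule: F_induct)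
    (simp_all add: coord_0 coord_minus coord_frag T_closed R_T basisD(4))

text \<open>On a generator (s, m): \<open>m\<close> is the sum of the f_x(m) x, and moving the
  scalars f_x(m) across the tensor sign produces the coordinates s f_x(m). The rest is additivity
  modulo \<open>U\<close>.\<close>

lemma reconstruct:
  assumes "a \<in> carrier F"
  shows "a - (\<Sum>x\<in>X. frag_of (coord a x, x)) \<in> U"
  using assms
proof (induction rule: F_induct)
  case zero
  have "(\<Sum>x\<in>X. frag_of (coord 0 x, x)) \<in> U"
    using U_zero_left basisD(3) by (intro U_sum) (simp add: coord_0)
  then show ?case using U_closed(3) by simp
next
  case (frag s m)
  let ?g = "\<lambda>x. f x m \<odot>\<^bsub>M\<^esub> x"
  have g: "?g \<in> X \<rightarrow> carrier M" using basisD(3,4) frag smult_closed by auto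
  have "frag_of (s, m) - (\<Sum>x\<in>X. frag_of (s, ?g x)) \<in> U"
    using U_finsum_right[OF frag(1) basisD(1) g] basisD(8)[OF frag(2)] by simp
  moreover have "(\<Sum>x\<in>X. frag_of (s \<otimes>\<^bsub>S\<^esub> f x m, x) - frag_of (s, ?g x)) \<in> U"
    using frag basisD(3,4) by (intro U_sum U_smult) auto
  ultimately have "(frag_of (s, m) - (\<Sum>x\<in>X. frag_of (s, ?g x))) -
      (\<Sum>x\<in>X. frag_of (s \<otimes>\<^bsub>S\<^esub> f x m, x) - frag_of (s, ?g x)) \<in> U"
    by (rule U_closed(4))
  then show ?case using frag by (simp add: coord_frag sum_subtractf)
next
  case (diff a b)
  have "(\<Sum>x\<in>X. frag_of (coord a x, x) - frag_of (coord b x, x) -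
      frag_of (coord a x \<ominus>\<^bsub>S\<^esub> coord b x, x)) \<in> U"
    using diff coord_T basisD(3) by (intro U_sum U_minus_left) auto
  then have "(a - (\<Sum>x\<in>X. frag_of (coord a x, x))) - (b - (\<Sum>x\<in>X. frag_of (coord b x, x))) +
      (\<Sum>x\<in>X. frag_of (coord a x, x) - frag_of (coord b x, x) -
        frag_of (coord a x \<ominus>\<^bsub>S\<^esub> coord b x, x)) \<in> U"
    by (intro U_closed(2)[OF U_closed(4)[OF diff(3,4)]])
  then show ?case using diff by (simp add: coord_minus sum_subtractf sum.distrib algebra_simps)
qed

lemma coord_relation:
  assumes "a \<in> tensor_relations R T M"
  shows "coord a x = \<zero>\<^bsub>S\<^esub>"
proof -
  have fS: "f x m \<in> carrier S" if "m \<in> carrier M" for m using that basisD(4) R_S by blast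
  have cancel: "u \<oplus>\<^bsub>S\<^esub> v \<ominus>\<^bsub>S\<^esub> u \<ominus>\<^bsub>S\<^esub> v = \<zero>\<^bsub>S\<^esub>" if "u \<in> carrier S" "v \<in> carrier S" for u v
    using that S.eq_minusI[of v u "u \<oplus>\<^bsub>S\<^esub> v"] S.a_comm[of u v] S.r_right_minus_eq[of v v] by simp
  consider s t m where "a = frag_of (s \<oplus>\<^bsub>S\<^esub> t, m) - frag_of (s, m) - frag_of (t, m)"
      "s \<in> carrier T" "t \<in> carrier T" "m \<in> carrier M"
    | s m n where "a = frag_of (s, m \<oplus>\<^bsub>M\<^esub> n) - frag_of (s, m) - frag_of (s, n)"
      "s \<in> carrier T" "m \<in> carrier M" "n \<in> carrier M"
    | s r m where "a = frag_of (s \<otimes>\<^bsub>S\<^esub> r, m) - frag_of (s, r \<odot>\<^bsub>M\<^esub> m)"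
      "s \<in> carrier T" "r \<in> carrier R" "m \<in> carrier M"
    using assms unfolding tensor_relations_def by (auto simp: add_T mult_T R_T)
  then show ?thesis
  proof cases
    case (1 s t m)
    then show ?thesis
      using fS T_S T_closed
      by (simp add: coord_minus coord_frag F_closed S.l_distr cancel)
  next
    case (2 s m n)
    then show ?thesis
      using fS T_S basisD(4)
      by (simp add: coord_minus coord_frag F_closed basisD(6) add_R S.r_distr cancel)
  next
    case (3 s r m)
    then have "s \<otimes>\<^bsub>S\<^esub> r \<otimes>\<^bsub>S\<^esub> f x m = s \<otimes>\<^bsub>S\<^esub> (r \<otimes>\<^bsub>R\<^esub> f x m)"
      using fS T_S R_S basisD(4) by (simp add: S.m_assoc mult_R)
    then show ?thesis
      using 3 fS T_S R_S R_T T_closed basisD(4) smult_closed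
      by (simp add: coord_minus coord_frag F_closed basisD(7) S.minus_eq S.r_neg)
  qed
qed

text \<open>The relations have zero coordinates, so coordinates descend to the quotient; by
  \<open>reconstruct\<close> they determine the class. Equality in the tensor product thus becomes
  equality of rows.\<close>

lemma U_iff:
  assumes a: "a \<in> carrier F"
  shows "a \<in> U \<longleftrightarrow> coord a = (\<lambda>_. \<zero>\<^bsub>S\<^esub>)"
proof
  assume "a \<in> U"
  moreover have "U \<subseteq> {a \<in> carrier F. coord a x = \<zero>\<^bsub>S\<^esub>}" for x
  proof -
    interpret h: group_hom F "add_monoid S" "\<lambda>a. coord a x"
      using F_sel(4) S.a_group coord_hom by (intro group_hom.intro group_hom_axioms.intro) auto
    have "subgroup (kernel F (add_monoid S) (\<lambda>a. coord a x)) F" by (rule h.subgroup_kernel)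
    moreover have "tensor_relations R T M \<subseteq> kernel F (add_monoid S) (\<lambda>a. coord a x)"
      using coord_relation relations_in_F by (auto simp: kernel_def)
    ultimately have "U \<subseteq> kernel F (add_monoid S) (\<lambda>a. coord a x)"
      unfolding tensor_subgroup_def by (intro group.generate_subgroup_incl[OF F_sel(4)])
    then show ?thesis by (auto simp: kernel_def)
  qed
  ultimately show "coord a = (\<lambda>_. \<zero>\<^bsub>S\<^esub>)" by blast
next
  assume 0: "coord a = (\<lambda>_. \<zero>\<^bsub>S\<^esub>)"
  then have "(\<Sum>x\<in>X. frag_of (coord a x, x)) \<in> U"
    using U_zero_left basisD(3) by (intro U_sum) simp
  from U_closed(2)[OF reconstruct[OF a] this] show "a \<in> U" by simp
qed

lemma coord_eq_iff:
  assumes "a \<in> carrier F" "b \<in> carrier F"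
  shows "a - b \<in> U \<longleftrightarrow> coord a = coord b"
  using U_iff[OF F_closed(3)[OF assms]] coord_S assms
  by (auto simp: coord_minus fun_eq_iff S.r_right_minus_eq)

lemma coset_eq: "U #>\<^bsub>F\<^esub> a = (\<lambda>u. u + a) ` U"
  by (auto simp: r_coset_def F_sel)

lemma coset_eq_iff:
  assumes "a \<in> carrier F" "b \<in> carrier F"
  shows "U #>\<^bsub>F\<^esub> a = U #>\<^bsub>F\<^esub> b \<longleftrightarrow> coord a = coord b"
proof -
  have "U #>\<^bsub>F\<^esub> a = U #>\<^bsub>F\<^esub> b \<longleftrightarrow> a - b \<in> U"
  proof
    assume "U #>\<^bsub>F\<^esub> a = U #>\<^bsub>F\<^esub> b"
    then have "0 + a \<in> (\<lambda>u. u + b) ` U" using U_closed(1) unfolding coset_eq by blast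
    then show "a - b \<in> U" by auto
  next
    assume ab: "a - b \<in> U"
    show "U #>\<^bsub>F\<^esub> a = U #>\<^bsub>F\<^esub> b" unfolding coset_eq
    proof (intro equalityI image_subsetI)
      fix u assume "u \<in> U"
      then show "u + a \<in> (\<lambda>u. u + b) ` U" "u + b \<in> (\<lambda>u. u + a) ` U"
        using U_closed(2,4)[OF _ ab] by (auto intro: image_eqI[of _ _ "u + (a - b)"] image_eqI[of _ _ "u - (a - b)"])
    qed
  qed
  then show ?thesis using coord_eq_iff[OF assms] by simp
qed

lemma normal_U: "U \<lhd> F"
  using comm_group.subgroup_imp_normal[OF F_sel(3) subgroup_U] .

lemma tensor_product_sel:
  "carrier (tensor_product R T M) = (\<lambda>a. U #>\<^bsub>F\<^esub> a) ` carrier F"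
  "\<one>\<^bsub>tensor_product R T M\<^esub> = U #>\<^bsub>F\<^esub> 0"
  "a \<in> carrier F \<Longrightarrow> b \<in> carrier F \<Longrightarrow>
    (U #>\<^bsub>F\<^esub> a) \<otimes>\<^bsub>tensor_product R T M\<^esub> (U #>\<^bsub>F\<^esub> b) = U #>\<^bsub>F\<^esub> (a + b)"
  "comm_group (tensor_product R T M)"
  using normal.rcos_sum[OF normal_U] comm_group.abelian_FactGroup[OF F_sel(3) subgroup_U]
  by (auto simp: tensor_product_def carrier_FactGroup F_sel coset_eq)

text \<open>The generators \<open>X\<close> need not be a basis, so the coordinates of this
  combination are \<open>w\<close> times the idempotent matrix, in general different from
  \<open>w\<close>.\<close>

lemma coord_combination:
  assumes "w \<in> UNIV \<rightarrow> carrier T"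
  shows "(\<Sum>x\<in>X. frag_of (w x, x)) \<in> carrier F"
    "coord (\<Sum>x\<in>X. frag_of (w x, x)) = S.vecmat X w (\<lambda>x y. f y x)"
proof -
  show "(\<Sum>x\<in>X. frag_of (w x, x)) \<in> carrier F"
    using assms basisD(3) by (intro F_sum_closed F_closed) auto
  have w: "w x \<in> carrier T" for x using assms by auto
  show "coord (\<Sum>x\<in>X. frag_of (w x, x)) = S.vecmat X w (\<lambda>x y. f y x)"
  proof
    fix y
    have "coord (\<Sum>x\<in>X. frag_of (w x, x)) y = (\<Oplus>\<^bsub>S\<^esub>x\<in>X. coord (frag_of (w x, x)) y)"
      using w basisD(3) by (intro coord_sum F_closed) auto
    also have "\<dots> = S.vecmat X w (\<lambda>x y. f y x) y"
      unfolding S.vecmat_def using w basisD(3,4) T_S R_S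
      by (intro S.finsum_cong') (simp_all add: coord_frag Pi_def)
    finally show "coord (\<Sum>x\<in>X. frag_of (w x, x)) y = S.vecmat X w (\<lambda>x y. f y x) y" .
  qed
qed

end

context tensor_coords
begin

lemma expand:
  assumes L: "L \<in> carrier M \<rightarrow> carrier R"
    "\<And>m n. m \<in> carrier M \<Longrightarrow> n \<in> carrier M \<Longrightarrow> L (m \<oplus>\<^bsub>M\<^esub> n) = L m \<oplus>\<^bsub>R\<^esub> L n"
    "\<And>r m. r \<in> carrier R \<Longrightarrow> m \<in> carrier M \<Longrightarrow> L (r \<odot>\<^bsub>M\<^esub> m) = r \<otimes>\<^bsub>R\<^esub> L m"
    and m: "m \<in> carrier M"
  shows "L m = (\<Oplus>\<^bsub>S\<^esub>x\<in>X. f x m \<otimes>\<^bsub>S\<^esub> L x)"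
proof -
  have fx: "f x m \<odot>\<^bsub>M\<^esub> x \<in> carrier M" if "x \<in> X" for x
    using that m basisD(3,4) smult_closed by simp
  have "L m = L (\<Oplus>\<^bsub>M\<^esub>x\<in>X. f x m \<odot>\<^bsub>M\<^esub> x)" using basisD(8)[OF m] by simp
  also have "\<dots> = (\<Oplus>\<^bsub>R\<^esub>x\<in>X. L (f x m \<odot>\<^bsub>M\<^esub> x))"
    using fx by (intro additive_finsum L R.abelian_group_axioms) auto
  also have "\<dots> = (\<Oplus>\<^bsub>R\<^esub>x\<in>X. f x m \<otimes>\<^bsub>S\<^esub> L x)"
    using m basisD(3,4) L by (intro R.finsum_cong') (auto simp: mult_R[symmetric] Pi_iff)
  also have "\<dots> = (\<Oplus>\<^bsub>S\<^esub>x\<in>X. f x m \<otimes>\<^bsub>S\<^esub> L x)"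
    using m basisD(3,4) L by (intro finsum_R) (auto simp: mult_R[symmetric] Pi_iff)
  finally show ?thesis .
qed

end

section \<open>Induced maps as matrices\<close>

locale tensor_coords_hom =
  M: tensor_coords R S T M X f + N: tensor_coords R S T N Y h
  for R :: "('r, 'k) ring_scheme" and S :: "('r, 'l) ring_scheme" and T :: "('r, 'n) ring_scheme"
    and M :: "('r, 'm) module" and X f and N :: "('r, 'p) module" and Y h +
  fixes d :: "'m \<Rightarrow> 'p"
  assumes d: "d \<in> left_module_hom R M N"
begin

abbreviation "push \<equiv> frag_extend (\<lambda>(s, m). frag_of (s, d m))"

lemma d_sel:
  "m \<in> carrier M \<Longrightarrow> d m \<in> carrier N"
  "m \<in> carrier M \<Longrightarrow> n \<in> carrier M \<Longrightarrow> d (m \<oplus>\<^bsub>M\<^esub> n) = d m \<oplus>\<^bsub>N\<^esub> d n"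
  "r \<in> carrier R \<Longrightarrow> m \<in> carrier M \<Longrightarrow> d (r \<odot>\<^bsub>M\<^esub> m) = r \<odot>\<^bsub>N\<^esub> d m"
  using d by (auto simp: left_module_hom_def)

lemma push_closed: "a \<in> carrier M.F \<Longrightarrow> push a \<in> carrier N.F"
  by (induction rule: M.F_induct) (auto simp: frag_extend_diff intro: N.F_closed d_sel)

lemma expand_hom:
  assumes "m \<in> carrier M"
  shows "h y (d m) = (\<Oplus>\<^bsub>S\<^esub>x\<in>X. f x m \<otimes>\<^bsub>S\<^esub> h y (d x))"
  using M.expand[of "\<lambda>m. h y (d m)" m] assms d_sel N.basisD(4,6,7) by simp

text \<open>For a generator this is \<open>expand_hom\<close> multiplied by \<open>s\<close> from
  the left; both sides are compatible with differences.\<close>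

lemma coord_push:
  assumes "a \<in> carrier M.F"
  shows "N.coord (push a) = M.S.vecmat X (M.coord a) (\<lambda>x y. h y (d x))"
  using assms
proof (induction rule: M.F_induct)
  have hS: "h y (d x) \<in> carrier S" if "x \<in> X" for x y
    using that M.basisD(3) N.basisD(4) d_sel(1) M.R_S by blast
  {
    case zero
    show ?case using hS by (simp add: M.coord_0[abs_def] N.coord_0[abs_def] M.S.vecmat_zero_left)
  next
    case (frag s m)
    have fS: "f x m \<in> carrier S" for x using frag M.basisD(4) M.R_S by blast
    show ?case
    proof
      fix y
      have "N.coord (push (frag_of (s, m))) y = s \<otimes>\<^bsub>S\<^esub> h y (d m)"
        using frag d_sel by (simp add: N.coord_frag)
      also have "\<dots> = (\<Oplus>\<^bsub>S\<^esub>x\<in>X. s \<otimes>\<^bsub>S\<^esub> (f x m \<otimes>\<^bsub>S\<^esub> h y (d x)))"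
        unfolding expand_hom[OF frag(2)]
        using frag M.basisD(1) fS hS M.T_S by (intro M.S.finsum_rdistr) auto
      also have "\<dots> = M.S.vecmat X (M.coord (frag_of (s, m))) (\<lambda>x y. h y (d x)) y"
        unfolding M.S.vecmat_def using frag fS hS M.T_S
        by (intro M.S.finsum_cong') (auto simp: M.coord_frag M.S.m_assoc)
      finally show "N.coord (push (frag_of (s, m))) y =
        M.S.vecmat X (M.coord (frag_of (s, m))) (\<lambda>x y. h y (d x)) y" .
    qed
  next
    case (diff a b)
    have "M.coord (a - b) = (\<lambda>x. M.coord a x \<ominus>\<^bsub>S\<^esub> M.coord b x)"
      using diff by (auto simp: M.coord_minus)
    then show ?case
      using diff hS push_closed M.coord_S
      by (auto simp: frag_extend_diff N.coord_minus M.S.vecmat_minus_left)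
  }
qed

text \<open>Members of one coset have the same coordinates, and by \<open>coord_push\<close> these
  determine the coordinates of the image. Hence all cosets in the union coincide.\<close>

lemma tensor_map_coset:
  assumes a: "a \<in> carrier M.F"
  shows "tensor_map R T N d (M.U #>\<^bsub>M.F\<^esub> a) = N.U #>\<^bsub>N.F\<^esub> push a"
proof -
  have "N.U #>\<^bsub>N.F\<^esub> push x = N.U #>\<^bsub>N.F\<^esub> push a"
    if x_in: "x \<in> M.U #>\<^bsub>M.F\<^esub> a" for x
  proof -
    obtain u where u: "u \<in> M.U" "x = u + a" using x_in by (auto simp: M.coset_eq)
    have x: "x \<in> carrier M.F" using u a M.U_F M.F_closed(2) by blast
    have "M.coord x = M.coord a"
      using M.coord_eq_iff[OF x a] u by simp
    then show ?thesis
      using N.coset_eq_iff[OF push_closed[OF x] push_closed[OF a]] coord_push[OF x] coord_push[OF a]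
      by simp
  qed
  moreover have "a \<in> M.U #>\<^bsub>M.F\<^esub> a" using M.U_closed(1) by (force simp: M.coset_eq)
  ultimately show ?thesis unfolding tensor_map_def by blast
qed

lemma tensor_map_hom: "tensor_map R T N d \<in> hom (tensor_product R T M) (tensor_product R T N)"
proof (rule homI)
  fix K L assume "K \<in> carrier (tensor_product R T M)" "L \<in> carrier (tensor_product R T M)"
  then obtain a b where ab: "a \<in> carrier M.F" "b \<in> carrier M.F"
      "K = M.U #>\<^bsub>M.F\<^esub> a" "L = M.U #>\<^bsub>M.F\<^esub> b"
    by (auto simp: M.tensor_product_sel)
  show "tensor_map R T N d K \<in> carrier (tensor_product R T N)"
    using ab push_closed by (simp add: tensor_map_coset N.tensor_product_sel)
  show "tensor_map R T N d (K \<otimes>\<^bsub>tensor_product R T M\<^esub> L) =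
      tensor_map R T N d K \<otimes>\<^bsub>tensor_product R T N\<^esub> tensor_map R T N d L"
    using ab push_closed
    by (simp add: tensor_map_coset N.tensor_product_sel M.tensor_product_sel M.F_closed frag_extend_add)
qed

end

text \<open>This is \<open>coord_push\<close> for the identity map, whose matrix is the idempotent.
  So every coordinate row is a chain.\<close>

lemma (in tensor_coords) coord_idem:
  assumes "a \<in> carrier F"
  shows "S.vecmat X (coord a) (\<lambda>x y. f y x) = coord a"
proof -
  interpret id: tensor_coords_hom R S T M X f M X f "\<lambda>m. m"
    by unfold_locales (auto simp: left_module_hom_def)
  have "frag_extend (\<lambda>(s, m). frag_of (s, m)) a = a"
    using frag_expansion[of a] by (simp add: case_prod_unfold)
  then show ?thesis using id.coord_push[OF assms] by simp
qed

section \<open>The whole complex in coordinates\<close>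

locale based_complex = base_change R S T
  for R :: "('r, 'k) ring_scheme" and S :: "('r, 'l) ring_scheme" and T :: "('r, 'n) ring_scheme" +
  fixes C :: "int \<Rightarrow> ('r, 'm) module" and d :: "int \<Rightarrow> 'm \<Rightarrow> 'm"
    and X :: "int \<Rightarrow> 'm set" and f :: "int \<Rightarrow> 'm \<Rightarrow> 'm \<Rightarrow> 'r"
  assumes cc: "chain_complex R C d" and db: "\<And>i. dual_basis R (C i) (X i) (f i)"
begin

text \<open>The indices are swapped because vectors are rows: row \<open>x\<close> has to consist of
  the coordinates of the generator \<open>x\<close>, or of its differential.\<close>

abbreviation "e \<equiv> \<lambda>i x y. f i y x"
abbreviation "D \<equiv> \<lambda>i x y. f (i - 1) y (d i x)"

lemma coords: "tensor_coords R S T (C i) (X i) (f i)"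
  using cc db base_change_axioms
  by (auto simp: chain_complex_def intro!: tensor_coords.intro tensor_coords_axioms.intro)

lemma coords_hom:
  "tensor_coords_hom R S T (C i) (X i) (f i) (C (i - 1)) (X (i - 1)) (f (i - 1)) (d i)"
  using cc coords by (auto simp: chain_complex_def intro!: tensor_coords_hom.intro tensor_coords_hom_axioms.intro)

lemma coord_zero: "f i y \<zero>\<^bsub>C i\<^esub> = \<zero>\<^bsub>S\<^esub>"
proof -
  interpret M: tensor_coords R S T "C i" "X i" "f i" by (rule coords)
  have "f i y \<zero>\<^bsub>C i\<^esub> \<oplus>\<^bsub>R\<^esub> f i y \<zero>\<^bsub>C i\<^esub> = f i y \<zero>\<^bsub>C i\<^esub>"
    using M.basisD(6)[of "\<zero>\<^bsub>C i\<^esub>" "\<zero>\<^bsub>C i\<^esub>" y] by simp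
  then show ?thesis using M.basisD(4)[of "\<zero>\<^bsub>C i\<^esub>" y] R.add.r_cancel_one zero_R by auto
qed

text \<open>Each identity expands a functional along the generators: at a generator for
  \<open>ee\<close>, at its differential for \<open>De\<close>, and with a differential inserted for
  \<open>eD\<close> and \<open>DD\<close>; the last then reduces to d d = 0.\<close>

sublocale mat: matrix_complex S X e D
proof
  fix i x assume x: "x \<in> X i"
  interpret h: tensor_coords_hom R S T "C i" "X i" "f i" "C (i - 1)" "X (i - 1)" "f (i - 1)" "d i"
    by (rule coords_hom)
  interpret h': tensor_coords_hom R S T "C (i - 1)" "X (i - 1)" "f (i - 1)" "C (i - 1 - 1)"
    "X (i - 1 - 1)" "f (i - 1 - 1)" "d (i - 1)"
    by (rule coords_hom)
  have xC: "x \<in> carrier (C i)" using h.M.basisD(3) x by simp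
  show "f i y x \<in> carrier S" for y using h.M.basisD(4) xC R_S by simp
  show "f (i - 1) y (d i x) \<in> carrier S" for y using h.N.basisD(4) xC R_S h.d_sel(1) by simp
  have dx: "d i x \<in> carrier (C (i - 1))" using h.d_sel(1)[OF xC] .
  show "S.vecmat (X i) (e i x) (e i) = e i x"
    unfolding S.vecmat_def using h.M.basisD(4,6,7) xC
    by (intro ext h.M.expand[where L = "f i y" for y, symmetric]) auto
  show "S.vecmat (X i) (e i x) (D i) = D i x"
    unfolding S.vecmat_def by (intro ext h.expand_hom[OF xC, symmetric])
  show "S.vecmat (X (i - 1)) (D i x) (e (i - 1)) = D i x"
    unfolding S.vecmat_def using h.N.basisD(4,6,7) dx
    by (intro ext h.N.expand[where L = "f (i - 1) y" for y, symmetric]) auto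
  have "d (i - 1) (d i x) = \<zero>\<^bsub>C (i - 1 - 1)\<^esub>"
    using cc xC by (simp add: chain_complex_def)
  then show "S.vecmat (X (i - 1)) (D i x) (D (i - 1)) = (\<lambda>_. \<zero>\<^bsub>S\<^esub>)"
    unfolding S.vecmat_def
    using h'.expand_hom[OF dx, symmetric] coord_zero[of "i - 1 - 1"] by simp
next
  show "finite (X i)" for i using dual_basisD(1)[OF db] .
qed

text \<open>Cosets correspond to coordinate rows by \<open>coset_eq_iff\<close>, and the
  differential to multiplication by \<open>D\<close>. As \<open>mat\<close> does not depend on
  \<open>T\<close>, the rational hypothesis and the localized conclusion come to speak of the same
  matrices.\<close>

lemma tensor_homology_trivial_iff:
  "trivial_group (tensor_homology R T C d i) \<longleftrightarrow> mat.exact_at (carrier T) i"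
proof -
  interpret h: tensor_coords_hom R S T "C i" "X i" "f i" "C (i - 1)" "X (i - 1)" "f (i - 1)" "d i"
    by (rule coords_hom)
  have "tensor_coords_hom R S T (C (i + 1)) (X (i + 1)) (f (i + 1)) (C i) (X i) (f i) (d (i + 1))"
    using coords_hom[of "i + 1"] by simp
  then interpret h1: tensor_coords_hom R S T "C (i + 1)" "X (i + 1)" "f (i + 1)" "C i" "X i" "f i" "d (i + 1)" .
  let ?tp = "\<lambda>i. tensor_product R T (C i)"
  let ?\<delta> = "\<lambda>i. tensor_map R T (C (i - 1)) (d i)"
  have coord0: "h.N.coord 0 = (\<lambda>_. \<zero>\<^bsub>S\<^esub>)" using h.N.coord_0 by auto
  have push_push: "h.N.coord (h.push (h1.push a)) = (\<lambda>_. \<zero>\<^bsub>S\<^esub>)" if a: "a \<in> carrier h1.M.F" for a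
  proof -
    have c: "h1.M.coord a x \<in> carrier S" for x using h1.M.coord_S[OF a] .
    have "h.N.coord (h.push (h1.push a)) = S.vecmat (X i) (S.vecmat (X (i + 1)) (h1.M.coord a) (D (i + 1))) (D i)"
      using h.coord_push[OF h1.push_closed[OF a]] h1.coord_push[OF a] by simp
    also have "\<dots> = S.vecmat (X (i + 1)) (h1.M.coord a) (\<lambda>x. S.vecmat (X i) (D (i + 1) x) (D i))"
      using c mat.finX mat.D_closed[of _ "i + 1"] mat.D_closed[of _ i]
      by (intro S.vecmat_assoc) auto
    also have "\<dots> = (\<lambda>_. \<zero>\<^bsub>S\<^esub>)"
      using c mat.DD[of _ "i + 1"] by (intro S.vecmat_zero_right) (simp_all add: fun_eq_iff)
    finally show ?thesis .
  qed
  have "trivial_group (tensor_homology R T C d i) \<longleftrightarrow>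
      kernel (?tp i) (?tp (i - 1)) (?\<delta> i) \<subseteq> ?\<delta> (i + 1) ` carrier (?tp (i + 1))"
    unfolding tensor_homology_def
  proof (rule trivial_homology_iff)
    show "comm_group (?tp j)" for j
      using tensor_coords.tensor_product_sel(4)[OF coords] .
    show "?\<delta> j \<in> hom (?tp j) (?tp (j - 1))" for j
      using tensor_coords_hom.tensor_map_hom[OF coords_hom] .
    fix K assume "K \<in> carrier (?tp (i + 1))"
    then obtain a where a: "a \<in> carrier h1.M.F" "K = h1.M.U #>\<^bsub>h1.M.F\<^esub> a"
      by (auto simp: h1.M.tensor_product_sel)
    have "?\<delta> i (?\<delta> (i + 1) K) = h.N.U #>\<^bsub>h.N.F\<^esub> h.push (h1.push a)"
      using h1.tensor_map_coset[OF a(1)] h.tensor_map_coset[OF h1.push_closed[OF a(1)]] a(2) by simp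
    also have "\<dots> = h.N.U #>\<^bsub>h.N.F\<^esub> 0"
      using h.N.coset_eq_iff[OF h.push_closed[OF h1.push_closed[OF a(1)]] h.N.F_closed(1)]
        push_push[OF a(1)] coord0 by simp
    finally show "?\<delta> i (?\<delta> (i + 1) K) = \<one>\<^bsub>?tp (i - 1)\<^esub>" by (simp add: h.N.tensor_product_sel)
  qed
  also have "\<dots> \<longleftrightarrow> (\<forall>a\<in>carrier h.M.F. h.N.coord (h.push a) = (\<lambda>_. \<zero>\<^bsub>S\<^esub>) \<longrightarrow>
      (\<exists>b\<in>carrier h1.M.F. h.M.coord (h1.push b) = h.M.coord a))" (is "?L \<longleftrightarrow> ?Q")
  proof -
    have ker: "h.M.U #>\<^bsub>h.M.F\<^esub> a \<in> kernel (?tp i) (?tp (i - 1)) (?\<delta> i) \<longleftrightarrow>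
        h.N.coord (h.push a) = (\<lambda>_. \<zero>\<^bsub>S\<^esub>)" if "a \<in> carrier h.M.F" for a
      using that h.N.coset_eq_iff[OF h.push_closed[OF that] h.N.F_closed(1)] coord0
      by (simp add: kernel_def h.tensor_map_coset h.M.tensor_product_sel h.N.tensor_product_sel)
    have img: "h.M.U #>\<^bsub>h.M.F\<^esub> a \<in> ?\<delta> (i + 1) ` carrier (?tp (i + 1)) \<longleftrightarrow>
        (\<exists>b\<in>carrier h1.M.F. h.M.coord (h1.push b) = h.M.coord a)" if a: "a \<in> carrier h.M.F" for a
    proof -
      have "?\<delta> (i + 1) ` carrier (?tp (i + 1)) = (\<lambda>b. h.M.U #>\<^bsub>h.M.F\<^esub> h1.push b) ` carrier h1.M.F"
        using h1.tensor_map_coset by (simp add: h1.M.tensor_product_sel image_image)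
      moreover have "h.M.U #>\<^bsub>h.M.F\<^esub> a = h.M.U #>\<^bsub>h.M.F\<^esub> h1.push b \<longleftrightarrow>
          h.M.coord (h1.push b) = h.M.coord a" if "b \<in> carrier h1.M.F" for b
        using h.M.coset_eq_iff[OF a h1.push_closed[OF that]] by auto
      ultimately show ?thesis by (simp only: image_iff cong: bex_cong)
    qed
    have "kernel (?tp i) (?tp (i - 1)) (?\<delta> i) \<subseteq> (\<lambda>a. h.M.U #>\<^bsub>h.M.F\<^esub> a) ` carrier h.M.F"
      by (auto simp: kernel_def h.M.tensor_product_sel)
    then have "?L \<longleftrightarrow> (\<forall>a\<in>carrier h.M.F. h.M.U #>\<^bsub>h.M.F\<^esub> a \<in> kernel (?tp i) (?tp (i - 1)) (?\<delta> i) \<longrightarrow>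
        h.M.U #>\<^bsub>h.M.F\<^esub> a \<in> ?\<delta> (i + 1) ` carrier (?tp (i + 1)))"
      by blast
    then show ?thesis using ker img by simp
  qed
  also have "\<dots> \<longleftrightarrow> mat.exact_at (carrier T) i"
  proof
    assume Q: ?Q
    show "mat.exact_at (carrier T) i" unfolding mat.exact_at_def
    proof
      fix v assume v: "v \<in> mat.cycles i \<inter> (UNIV \<rightarrow> carrier T)"
      \<comment> \<open>The coordinates of this element are \<open>v\<close> times the idempotent,
        which is \<open>v\<close> because \<open>v\<close> is a chain.\<close>
      define a where "a = (\<Sum>x\<in>X i. frag_of (v x, x))"
      have a: "a \<in> carrier h.M.F" "h.M.coord a = v"
        using h.M.coord_combination[of v] v mat.cyclesD(2)[of v i] by (auto simp: a_def)
      have "h.N.coord (h.push a) = (\<lambda>_. \<zero>\<^bsub>S\<^esub>)"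
        using h.coord_push[OF a(1)] a(2) v mat.cyclesD(3)[of v i] by simp
      then obtain b where b: "b \<in> carrier h1.M.F" "h.M.coord (h1.push b) = v"
        using Q a by auto
      then have "S.vecmat (X (i + 1)) (h1.M.coord b) (D (i + 1)) = v"
        using h1.coord_push[OF b(1)] by simp
      then show "\<exists>w\<in>UNIV \<rightarrow> carrier T. S.vecmat (X (i + 1)) w (D (i + 1)) = v"
        using h1.M.coord_T[OF b(1)] by blast
    qed
  next
    assume E: "mat.exact_at (carrier T) i"
    show ?Q
    proof (intro ballI impI)
      fix a assume a: "a \<in> carrier h.M.F" "h.N.coord (h.push a) = (\<lambda>_. \<zero>\<^bsub>S\<^esub>)"
      have "h.M.coord a \<in> mat.cycles i"
        using h.M.coord_idem[OF a(1)] h.coord_push[OF a(1)] a(2) h.M.coord_S[OF a(1)]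
        by (simp add: mat.cycles_def)
      then obtain w where w: "w \<in> UNIV \<rightarrow> carrier T"
          "S.vecmat (X (i + 1)) w (D (i + 1)) = h.M.coord a"
        using E h.M.coord_T[OF a(1)] unfolding mat.exact_at_def by blast
      \<comment> \<open>\<open>w\<close> need not be a chain, so the coordinates of \<open>b\<close>
        are \<open>w\<close> times \<open>e (i + 1)\<close>; since e D = D, the boundary is still
        that of \<open>w\<close>.\<close>
      define b where "b = (\<Sum>x\<in>X (i + 1). frag_of (w x, x))"
      have b: "b \<in> carrier h1.M.F" "h1.M.coord b = S.vecmat (X (i + 1)) w (e (i + 1))"
        using h1.M.coord_combination[OF w(1)] by (simp_all add: b_def)
      have wS: "w x \<in> carrier S" for x using w(1) T_S by auto
      have "h.M.coord (h1.push b) =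
          S.vecmat (X (i + 1)) (S.vecmat (X (i + 1)) w (e (i + 1))) (D (i + 1))"
        using h1.coord_push[OF b(1)] b(2) by simp
      also have "\<dots> = S.vecmat (X (i + 1)) w (\<lambda>x. S.vecmat (X (i + 1)) (e (i + 1) x) (D (i + 1)))"
        using wS mat.finX mat.e_closed mat.D_closed[of _ "i + 1"] by (intro S.vecmat_assoc) auto
      also have "\<dots> = S.vecmat (X (i + 1)) w (D (i + 1))"
        using wS mat.eD[of _ "i + 1"] mat.D_closed[of _ "i + 1"] by (intro S.vecmat_cong) auto
      finally show "\<exists>b\<in>carrier h1.M.F. h.M.coord (h1.push b) = h.M.coord a"
        using b(1) w(2) by auto
    qed
  qed
  finally show ?thesis .
qed

end

section \<open>Passage to finitely many inverted primes\<close>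

context novikov
begin

text \<open>Allowing every larger set of primes makes it possible to unite the sets found in the
  separate degrees. The differential is integral and hence defined over each localization; only
  \<open>s\<close> calls for denominators.\<close>

lemma exact_at_localized:
  fixes X :: "int \<Rightarrow> 'm set" and e D :: "int \<Rightarrow> 'm \<Rightarrow> 'm \<Rightarrow> 'g \<Rightarrow> rat"
  assumes mat: "matrix_complex (nov \<rat>) X e D"
    and D: "\<And>x y. x \<in> X (i + 1) \<Longrightarrow> D (i + 1) x y \<in> carrier (nov \<int>)"
    and D0: "\<And>x y. x \<in> X (i + 1) \<Longrightarrow> y \<notin> X i \<Longrightarrow> D (i + 1) x y = \<zero>\<^bsub>nov \<rat>\<^esub>"
    and e0: "\<And>x y. x \<in> X i \<Longrightarrow> y \<notin> X i \<Longrightarrow> e i x y = \<zero>\<^bsub>nov \<rat>\<^esub>"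
    and s: "matrix_complex.splits (nov \<rat>) X e D i s"
  shows "\<exists>P. finite P \<and> (\<forall>p\<in>P. prime p) \<and> (\<forall>Q. P \<subseteq> Q \<longrightarrow>
    matrix_complex.exact_at (nov \<rat>) X e D (carrier (nov (localized_ints Q))) i)"
proof -
  interpret matrix_complex "nov \<rat>" X e D by (rule mat)
  have sQ: "s x y \<in> carrier (nov \<rat>)" for x y using s by (simp add: splits_def)
  obtain c where c: "c \<ge> 0" "case_prod (D (i + 1)) ` (X (i + 1) \<times> X i) \<subseteq> filt (- c)"
    using finite_filt_bound[of "case_prod (D (i + 1)) ` (X (i + 1) \<times> X i)"] finX D_closed
    by (auto simp: image_subset_iff)
  \<comment> \<open>Entries in columns outside \<open>X i\<close> are zero and obey every bound, so
    the finite block determines \<open>c\<close>.\<close>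
  have Dc: "D (i + 1) x y \<in> filt (- c)" if "x \<in> X (i + 1)" for x y
    using that c(2) D0 filt_zero by (cases "y \<in> X i") (auto simp: image_subset_iff)
  have "\<exists>P y. finite P \<and> (\<forall>p\<in>P. prime p) \<and> y \<in> carrier (nov (localized_ints P)) \<and>
      s j k \<ominus>\<^bsub>nov \<rat>\<^esub> y \<in> filt (c + 1)" for j k
    using truncation[OF sQ] .
  then obtain p t where pt: "\<And>j k. finite (p j k) \<and> (\<forall>q\<in>p j k. prime q) \<and>
      t j k \<in> carrier (nov (localized_ints (p j k))) \<and> s j k \<ominus>\<^bsub>nov \<rat>\<^esub> t j k \<in> filt (c + 1)"
    by metis
  define P where "P = (\<Union>j\<in>X i. \<Union>k\<in>X (i + 1). p j k)"
  \<comment> \<open>Setting the entries outside the finite block to 0 makes the finitely many sets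
    \<open>p j k\<close> collected in \<open>P\<close> suffice.\<close>
  define s' where "s' j k = (if j \<in> X i \<and> k \<in> X (i + 1) then t j k else \<zero>\<^bsub>nov \<rat>\<^esub>)" for j k
  have "exact_at (carrier (nov (localized_ints Q))) i" if PQ: "P \<subseteq> Q" for Q
    unfolding exact_at_def
  proof
    let ?A = "localized_ints Q"
    note A = rat_subring_localized_ints[of Q] localized_ints_subset_Rats[of Q]
    have AQ: "x \<in> carrier (nov \<rat>)" if "x \<in> carrier (nov ?A)" for x
      using that nov_mono[OF A(2)] by blast
    fix v assume v: "v \<in> cycles i \<inter> (UNIV \<rightarrow> carrier (nov ?A))"
    then have vc: "v \<in> cycles i" and vA: "v x \<in> carrier (nov ?A)" for x by auto
    have vQ: "v x \<in> carrier (nov \<rat>)" for x using vA AQ by blast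
    \<comment> \<open>\<open>v\<close> is fixed by \<open>e i\<close>, whose columns outside
      \<open>X i\<close> vanish. So a common lower bound for its entries has to be found only on the
      finite set \<open>X i\<close>.\<close>
    have v0: "v x = \<zero>\<^bsub>nov \<rat>\<^esub>" if "x \<notin> X i" for x
    proof -
      have "v x = vecmat (X i) v (e i) x" using cyclesD(2)[OF vc] by simp
      also have "\<dots> = (\<Oplus>\<^bsub>nov \<rat>\<^esub>j\<in>X i. \<zero>\<^bsub>nov \<rat>\<^esub>)"
        unfolding vecmat_def using e0 that vQ by (intro finsum_cong') auto
      finally show ?thesis by (simp add: finsum_zero)
    qed
    \<comment> \<open>This bound depends on the cycle, while the truncation level c + 1 does not;
      that is why \<open>P\<close> could be fixed before \<open>v\<close>.\<close>
    obtain b where b: "v ` X i \<subseteq> filt (- b)"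
      using finite_filt_bound[of "v ` X i"] finX vQ by auto
    have vb: "v x \<in> filt (- b)" for x
      using b v0 filt_zero by (cases "x \<in> X i") auto
    have s'A: "s' j k \<in> carrier (nov ?A)" for j k
    proof (cases "j \<in> X i \<and> k \<in> X (i + 1)")
      case True
      then have "p j k \<subseteq> Q" using PQ by (auto simp: P_def)
      then have "carrier (nov (localized_ints (p j k))) \<subseteq> carrier (nov ?A)"
        by (intro nov_mono localized_ints_mono)
      then show ?thesis using True pt by (auto simp: s'_def)
    next
      case False
      then show ?thesis using subringE(2)[OF subring_nov[OF A]] by (auto simp: s'_def)
    qed
    show "\<exists>w\<in>UNIV \<rightarrow> carrier (nov ?A). vecmat (X (i + 1)) w (D (i + 1)) = v"
    proof (rule solve_by_approximation[OF A finX finX Dc _ c(1) sQ s'A _ _ _ vc vb vA])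
      show "D (i + 1) y x \<in> carrier (nov ?A)" if "y \<in> X (i + 1)" for x y
        using D[OF that] nov_mono[OF Ints_subset_localized_ints] by blast
      show "s x y \<ominus>\<^bsub>nov \<rat>\<^esub> s' x y \<in> filt (c + 1)" if "x \<in> X i" "y \<in> X (i + 1)" for x y
        using that pt by (simp add: s'_def)
      show "vecmat (X (i + 1)) (vecmat (X i) u s) (D (i + 1)) = u" if "u \<in> cycles i" for u
        using s that by (simp add: splits_def)
      show "(\<lambda>x. u x \<ominus>\<^bsub>nov \<rat>\<^esub> vecmat (X (i + 1)) (vecmat (X i) u s') (D (i + 1)) x) \<in> cycles i"
        if "u \<in> cycles i" for u
        using cyclesD(1)[OF that] AQ[OF s'A]
        by (intro minus_boundary_cycle that) (auto intro!: vecmat_closed)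
    qed
  qed
  moreover have "finite P" "\<forall>q\<in>P. prime q" using pt finX by (auto simp: P_def)
  ultimately show ?thesis by blast
qed

lemma group_ring_sel:
  "carrier (group_ring (rat_ring A) G) = {x \<in> carrier G \<rightarrow>\<^sub>E A. finite {g \<in> carrier G. x g \<noteq> 0}}"
  "\<zero>\<^bsub>group_ring (rat_ring A) G\<^esub> = (\<lambda>g\<in>carrier G. 0)"
  "add (group_ring (rat_ring A) G) = (\<lambda>x y. \<lambda>g\<in>carrier G. x g + y g)"
  "monoid.mult (group_ring (rat_ring A) G) = convolution (rat_ring A) G"
  by (simp_all add: group_ring_def convolution_ring_def rat_ring_def)

lemma group_ring_sub_nov: "carrier (group_ring (rat_ring A) G) \<subseteq> carrier (nov A)"
proof
  fix x assume x: "x \<in> carrier (group_ring (rat_ring A) G)"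
  then have "finite {g \<in> carrier G. x g \<noteq> 0 \<and> \<phi> g \<le> \<kappa>}" for \<kappa>
    by (auto simp: group_ring_sel intro: rev_finite_subset)
  then show "x \<in> carrier (nov A)" using x by (auto simp: group_ring_sel carrier_nov)
qed

text \<open>The ring laws of the integral group ring are a hypothesis because
  \<open>chain_complex\<close> already provides them through \<open>left_module\<close>.\<close>

lemma base_change_nov:
  assumes R: "ring (group_ring (rat_ring \<int>) G)" and A: "rat_subring A" "\<int> \<subseteq> A" "A \<subseteq> \<rat>"
  shows "base_change (group_ring (rat_ring \<int>) G) (nov \<rat>) (nov A)"
proof (intro base_change.intro base_change_axioms.intro R nov_ring subring_nov A)
  have Z: "rat_subring \<int>" "\<int> \<subseteq> (\<rat> :: rat set)" using rat_subring_Ints Ints_subset_Rats by auto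
  show "carrier (group_ring (rat_ring \<int>) G) \<subseteq> carrier (nov A)"
    using group_ring_sub_nov nov_mono[OF A(2)] by blast
  fix a b assume "a \<in> carrier (group_ring (rat_ring \<int>) G)" "b \<in> carrier (group_ring (rat_ring \<int>) G)"
  then have "a \<in> carrier (nov \<int>)" "b \<in> carrier (nov \<int>)" using group_ring_sub_nov by blast+
  then show "a \<otimes>\<^bsub>group_ring (rat_ring \<int>) G\<^esub> b = a \<otimes>\<^bsub>nov \<rat>\<^esub> b"
    using convolution_eq_conv[OF Z] by (simp add: group_ring_sel nov_sel)
next
  fix a b assume "a \<in> carrier (nov A)" "b \<in> carrier (nov A)"
  then show "a \<otimes>\<^bsub>nov A\<^esub> b = a \<otimes>\<^bsub>nov \<rat>\<^esub> b"
    using convolution_eq_conv[OF A(1,3)] by (simp add: nov_sel)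
qed (simp_all add: group_ring_sel nov_sel)

end

section \<open>Assembling the degrees\<close>

theorem proposition3p6:
  fixes G :: "('g, 'k) monoid_scheme"
    and \<phi> :: "'g \<Rightarrow> real"
    and n :: nat
    and C :: "int \<Rightarrow> ('g \<Rightarrow> rat, 'm) module"
    and d :: "int \<Rightarrow> 'm \<Rightarrow> 'm"
  assumes "group G"
    and "\<phi> \<in> hom G real_additive_group"
    and "\<exists>g\<in>carrier G. \<phi> g \<noteq> 0"
    and "chain_complex (group_ring (rat_ring \<int>) G) C d"
    and "\<And>i. fin_gen_module (group_ring (rat_ring \<int>) G) (C i)"
    and "\<And>i. projective_module (group_ring (rat_ring \<int>) G) (C i)"
    and "\<And>i. i < 0 \<Longrightarrow> carrier (C i) = {\<zero>\<^bsub>C i\<^esub>}"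
    and "\<And>i. i \<le> int n \<Longrightarrow> trivial_group
      (tensor_homology (group_ring (rat_ring \<int>) G) (novikov_ring (rat_ring \<rat>) G \<phi>) C d i)"
  shows "\<exists>P :: nat set. finite P \<and> (\<forall>p\<in>P. prime p) \<and>
    (\<forall>i \<le> int n. trivial_group
      (tensor_homology (group_ring (rat_ring \<int>) G)
        (novikov_ring (rat_ring (localized_ints P)) G \<phi>) C d i))"
proof -
  interpret novikov G \<phi> using assms(1,2) by (intro novikov.intro novikov_axioms.intro)
  let ?R = "group_ring (rat_ring \<int>) G"
  have lm: "left_module ?R (C i)" for i using assms(4) by (simp add: chain_complex_def)
  have R: "ring ?R" using lm by (simp add: left_module_def)
  have "\<exists>X f. dual_basis ?R (C i) X f" for i
    using left_module.dual_basis_exists[OF lm assms(5,6)] .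
  then obtain X f where db: "\<And>i. dual_basis ?R (C i) (X i) (f i)" by metis
  have complex: "based_complex ?R (nov \<rat>) (nov A) C d X f"
    if "rat_subring A" "\<int> \<subseteq> A" "A \<subseteq> \<rat>" for A
    using base_change_nov[OF R that] assms(4) db
    by (intro based_complex.intro based_complex_axioms.intro)
  \<comment> \<open>The case T = S fixes the matrices \<open>mat\<close> and turns the hypothesis
    into exactness over the rational Novikov ring.\<close>
  interpret based_complex ?R "nov \<rat>" "nov \<rat>" C d X f
    by (rule complex[OF rat_subring_Rats Ints_subset_Rats order_refl])
  have X0: "x = \<zero>\<^bsub>C i\<^esub>" if "i < 0" "x \<in> X i" for i x
    using dual_basisD(3)[OF db that(2)] assms(7)[OF that(1)] by simp
  have splits: "\<exists>s. mat.splits i s" if "i \<le> int n" for i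
    using X0 coord_zero assms(8) tensor_homology_trivial_iff that
    by (intro mat.splits_exists[of "int n"]) auto
  have loc: "\<exists>P. finite P \<and> (\<forall>p\<in>P. prime p) \<and> (\<forall>Q. P \<subseteq> Q \<longrightarrow>
      mat.exact_at (carrier (nov (localized_ints Q))) i)" if i: "i \<le> int n" for i
  proof -
    obtain s where s: "mat.splits i s" using splits[OF i] by blast
    have dC: "d (i + 1) x \<in> carrier (C i)" if "x \<in> X (i + 1)" for x
      using tensor_coords_hom.d_sel(1)[OF coords_hom[of "i + 1"]] dual_basisD(3)[OF db that] by simp
    show ?thesis
    proof (rule exact_at_localized[OF mat.matrix_complex_axioms _ _ _ s])
      show "f (i + 1 - 1) y (d (i + 1) x) \<in> carrier (nov \<int>)" if "x \<in> X (i + 1)" for x y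
        using dual_basisD(4)[OF db dC[OF that]] group_ring_sub_nov by auto
      show "f (i + 1 - 1) y (d (i + 1) x) = \<zero>\<^bsub>nov \<rat>\<^esub>" if "x \<in> X (i + 1)" "y \<notin> X i" for x y
        using dual_basisD(5)[OF db that(2) dC[OF that(1)]] zero_R by simp
      show "f i y x = \<zero>\<^bsub>nov \<rat>\<^esub>" if "x \<in> X i" "y \<notin> X i" for x y
        using dual_basisD(5)[OF db that(2) dual_basisD(3)[OF db that(1)]] zero_R by simp
    qed
  qed
  define P where "P i = (SOME P. finite P \<and> (\<forall>p\<in>P. prime p) \<and> (\<forall>Q. P \<subseteq> Q \<longrightarrow>
      mat.exact_at (carrier (nov (localized_ints Q))) i))" for i
  note P = someI_ex[OF loc, folded P_def]
  \<comment> \<open>Only the degrees from 0 to n contribute, which keeps the union finite; in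
    negative degrees exactness is proved directly.\<close>
  define Q where "Q = (\<Union>i\<in>{0..int n}. P i)"
  have "trivial_group (tensor_homology ?R (nov (localized_ints Q)) C d i)" if i: "i \<le> int n" for i
  proof -
    note A = rat_subring_localized_ints Ints_subset_localized_ints localized_ints_subset_Rats
    \<comment> \<open>The matrices of this second instance are built from the same \<open>X\<close>,
      \<open>f\<close> and \<open>d\<close>, so the statements about \<open>mat\<close> apply to
      it.\<close>
    interpret Q: based_complex ?R "nov \<rat>" "nov (localized_ints Q)" C d X f
      by (rule complex[OF A])
    have "mat.exact_at (carrier (nov (localized_ints Q))) i"
    proof (cases "i < 0")
      case True
      \<comment> \<open>In negative degrees all generators are zero, so the idempotent vanishes and
        the zero row is the only cycle.\<close>
      have "f i y x = \<zero>\<^bsub>nov \<rat>\<^esub>" if "x \<in> X i" for x y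
        using X0[OF True that] coord_zero by simp
      then have "v = (\<lambda>_. \<zero>\<^bsub>nov \<rat>\<^esub>)" if "v \<in> mat.cycles i" for v
        using mat.cyclesD(1,2)[OF that] S.vecmat_zero_right[of "X i" v "\<lambda>x y. f i y x"]
        by simp
      then show ?thesis
        unfolding mat.exact_at_def using mat.D_closed[of _ "i + 1"] Q.T_closed(1)
        by (auto intro!: bexI[of _ "\<lambda>_. \<zero>\<^bsub>nov \<rat>\<^esub>"] S.vecmat_zero_left)
    next
      case False
      then have "i \<in> {0..int n}" using i by simp
      then have "P i \<subseteq> Q" unfolding Q_def by (rule UN_upper)
      then show ?thesis using P[OF i] by blast
    qed
    then show ?thesis by (rule Q.tensor_homology_trivial_iff[THEN iffD2])
  qed
  moreover have "finite Q" "\<forall>p\<in>Q. prime p" using P by (auto simp: Q_def)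
  ultimately show ?thesis by blast
qed

end
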